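(* There is a closed, oligomorphic permutation group $G$ (on a countable set) which has a metrizable minimal flow in which all $G$-orbits are meagre.
   Context: The symmetric group on a countable set $X$ carries the topology of pointwise convergence; a closed permutation group on $X$ is a closed subgroup of it. A permutation group $G$ on $X$ is oligomorphic if $G$ has finitely many orbits on $X^n$ for every natural number $n$. A $G$-flow is a non-empty compact Hausdorff space on which $G$ acts continuously; it is minimal if every orbit is dense. *)

theory Defs
  imports "HOL-Analysis.Analysis" "HOL-Algebra.Group_Action"
begin

(* Permutations of X are the elements of Bij X: they are extensional, so two permutations that
   agree on X are equal. Pointwise convergence means convergence in the product of
   discrete copies of X. *)
definition sym_topology :: "'a set \<Rightarrow> ('a \<Rightarrow> 'a) topology" where
  "sym_topology X = subtopology (product_topology (\<lambda>_. discrete_topology X) X) (Bij X)"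

lemma topspace_sym_topology: "topspace (sym_topology X) = Bij X"
  by (auto simp: sym_topology_def PiE_def Bij_imp_extensional dest: Bij_imp_funcset)

definition permgroup :: "('a \<Rightarrow> 'a) set \<Rightarrow> 'a set \<Rightarrow> ('a \<Rightarrow> 'a) monoid" where
  "permgroup G X = BijGroup X\<lparr>carrier := G\<rparr>"

definition closed_permutation_group :: "('a \<Rightarrow> 'a) set \<Rightarrow> 'a set \<Rightarrow> bool" where
  "closed_permutation_group G X \<longleftrightarrow>
     subgroup G (BijGroup X) \<and> closedin (sym_topology X) G"

(* n-tuples over X are lists of length n; G acts on them coordinatewise. *)
definition oligomorphic :: "('a \<Rightarrow> 'a) set \<Rightarrow> 'a set \<Rightarrow> bool" where
  "oligomorphic G X \<longleftrightarrow>
     (\<forall>n::nat. finite (orbits (permgroup G X) {xs. length xs = n \<and> set xs \<subseteq> X} map))"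

(* The action is jointly continuous, G carrying the topology of pointwise convergence.
   The space Y is an arbitrary topology on an arbitrary subset of the type 'b. Every compact metrizable
   space has a homeomorphic copy on a subset of nat \<Rightarrow> real (the Hilbert cube), so taking 'b to be
   nat \<Rightarrow> real loses no metrizable flows. *)
definition flow ::
  "('a \<Rightarrow> 'a) set \<Rightarrow> 'a set \<Rightarrow> 'b topology \<Rightarrow> (('a \<Rightarrow> 'a) \<Rightarrow> 'b \<Rightarrow> 'b) \<Rightarrow> bool" where
  "flow G X Y \<phi> \<longleftrightarrow>
     topspace Y \<noteq> {} \<and> compact_space Y \<and> Hausdorff_space Y \<and>
     group_action (permgroup G X) (topspace Y) \<phi> \<and>
     continuous_map (prod_topology (subtopology (sym_topology X) G) Y) Y (\<lambda>(g, y). \<phi> g y)"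

definition minimal_flow ::
  "('a \<Rightarrow> 'a) set \<Rightarrow> 'a set \<Rightarrow> 'b topology \<Rightarrow> (('a \<Rightarrow> 'a) \<Rightarrow> 'b \<Rightarrow> 'b) \<Rightarrow> bool" where
  "minimal_flow G X Y \<phi> \<longleftrightarrow>
     flow G X Y \<phi> \<and>
     (\<forall>y\<in>topspace Y. Y closure_of (orbit (permgroup G X) \<phi> y) = topspace Y)"

definition nowhere_dense_in :: "'b topology \<Rightarrow> 'b set \<Rightarrow> bool" where
  "nowhere_dense_in Y A \<longleftrightarrow> A \<subseteq> topspace Y \<and> Y interior_of (Y closure_of A) = {}"

definition meagre_in :: "'b topology \<Rightarrow> 'b set \<Rightarrow> bool" where
  "meagre_in Y A \<longleftrightarrow>
     (\<exists>\<A>. countable \<A> \<and> (\<forall>N\<in>\<A>. nowhere_dense_in Y N) \<and> A = \<Union>\<A>)"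

end

theory Submission
  imports Defs
begin

text \<open>
  Hrushovski's construction. For a hypergraph with edge set \<open>E\<close> put
  \<open>\<delta>(A) = |A| - #{e \<in> E. e \<subseteq> A}\<close>. The finite hypergraphs in which \<open>|A| < 2 ^ \<delta>(A)\<close> for all \<open>A\<close>
  have free amalgamation over subsets \<open>A\<close> that are strong, i.e. \<open>\<delta>(A) < \<delta>(B)\<close> whenever
  \<open>A \<subset> B\<close>. The bound makes the strong closure of an \<open>n\<close>-set have fewer than \<open>2 ^ n\<close> points, so
  the automorphism group of the generic hypergraph is oligomorphic although there are edges of
  unboundedly many sizes.

  By Hall's theorem and compactness the edges can be oriented: every edge owns exactly one of its
  points and no point is owned twice. Orientations form a metrizable flow; take a minimal
  subflow. From a point \<open>a\<close> one reaches further points by passing to the edge that owns \<open>a\<close>, then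
  to the edges that own its points, and so on. The sizes of the edges met within \<open>n\<close> steps are
  bounded along the part of an orbit that comes from a fixed basepoint. If this part were dense
  in an open set, then by minimality there would be a finite set \<open>F\<close> such that in every
  orientation of the subflow some point of \<open>F\<close> meets within \<open>n\<close> steps, for every \<open>n\<close>, only edges
  of size at most a bound depending on \<open>n\<close> alone. But \<open>F\<close> has disjoint copies linked by large edges so that fewer points are left free than there
  are copies; in some copy all points are owned, and ownership must leave that copy through a
  large edge, because a finite set \<open>R\<close> contains fewer than \<open>|R|\<close> edges.
\<close>

section \<open>Predimension and strong subsets\<close>

text \<open>Why free amalgamation preserves the exponential bound: strong sets gain strictly, so if
  a set \<open>X\<close> in the amalgam lies in neither factor, each of its two halves has
  predimension at least 1 below that of \<open>X\<close>. Two sizes below \<open>2 ^ k\<close> then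
  add up to a size below \<open>2 ^ (k + 1)\<close>.

  Why orbits fall into countably many pieces: fix a point \<open>a\<close> and sort the translates
  of \<open>y\<close> by the image \<open>b\<close> of \<open>a\<close>. For all \<open>g\<close>
  with \<open>g a = b\<close> the set reached from \<open>b\<close> in the translate is the
  \<open>g\<close>-image of the one finite set reached from \<open>a\<close> in \<open>y\<close>, so
  its size bounds the edges met, uniformly in \<open>g\<close>.

  The order of choices shapes the last step. The bounds, one for each number of steps, come from
  \<open>y\<close> and \<open>a\<close> before the finite set \<open>F\<close> is known;
  \<open>F\<close> comes from compactness; then \<open>card F\<close> steps are enough, since a
  growing chain of sets inside \<open>F\<close> stabilises earlier. Only now is the bound a single
  number \<open>K\<close>, and the generic hypergraph has to link copies of this \<open>F\<close> by
  edges with more than \<open>K\<close> points. With edges of bounded size such bounds would hold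
  trivially and no contradiction could arise.\<close>

definition edges_in :: "'a set set \<Rightarrow> 'a set \<Rightarrow> 'a set set" where
  "edges_in E A = {e \<in> E. e \<subseteq> A}"

definition delta :: "'a set set \<Rightarrow> 'a set \<Rightarrow> int" where
  "delta E A = int (card A) - int (card (edges_in E A))"

text \<open>The size bound says that \<delta> exceeds the binary logarithm of the size. Since
  \<open>nat\<close> sends negative values to 0, the bound alone would still admit the empty set
  with negative predimension; \<open>0 \<le> delta E A\<close> excludes this, that is, it excludes
  the empty edge.\<close>

definition sparse :: "'a set set \<Rightarrow> 'a set \<Rightarrow> bool" where
  "sparse E V \<longleftrightarrow>
     (\<forall>A\<subseteq>V. finite A \<longrightarrow> 0 \<le> delta E A \<and> card A < 2 ^ nat (delta E A))"

text \<open>Strictness is what makes the size bound survive amalgamation, and it also forces a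
  strong closure to be of maximal size among the sets of least predimension.\<close>

definition strong :: "'a set set \<Rightarrow> 'a set \<Rightarrow> 'a set \<Rightarrow> bool" where
  "strong E A V \<longleftrightarrow> A \<subseteq> V \<and> (\<forall>B. finite B \<and> A \<subset> B \<and> B \<subseteq> V \<longrightarrow> delta E A < delta E B)"

text \<open>Embedding as an induced subhypergraph. Edges that leave \<open>A\<close> or its image
  are ignored, so neither edge set has to be cut down first.\<close>

definition embeds :: "'a set set \<Rightarrow> 'a set \<Rightarrow> 'b set set \<Rightarrow> ('a \<Rightarrow> 'b) \<Rightarrow> bool" where
  "embeds E A E' f \<longleftrightarrow> inj_on f A \<and> (\<forall>e\<subseteq>A. f ` e \<in> E' \<longleftrightarrow> e \<in> E)"

lemma finite_edges_in: "finite A \<Longrightarrow> finite (edges_in E A)"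
  by (rule finite_subset[of _ "Pow A"]) (auto simp: edges_in_def)

lemma delta_empty: "{} \<notin> E \<Longrightarrow> delta E {} = 0"
  by (auto simp: delta_def edges_in_def card_eq_0_iff)

lemma delta_le_card: "delta E A \<le> int (card A)"
  by (simp add: delta_def)

text \<open>Vertex counts are modular; the inequality comes from edges inside the union that lie in
  neither set.\<close>

lemma delta_submodular:
  assumes "finite A" "finite B"
  shows "delta E (A \<union> B) + delta E (A \<inter> B) \<le> delta E A + delta E B"
proof -
  have c: "card (A \<union> B) + card (A \<inter> B) = card A + card B"
    using card_Un_Int[OF assms] by simp
  have i: "edges_in E A \<inter> edges_in E B = edges_in E (A \<inter> B)"
    by (auto simp: edges_in_def)
  have "card (edges_in E A) + card (edges_in E B)
      = card (edges_in E A \<union> edges_in E B) + card (edges_in E (A \<inter> B))"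
    using card_Un_Int[OF finite_edges_in[OF assms(1)] finite_edges_in[OF assms(2)], of E E]
    by (simp add: i)
  also have "\<dots> \<le> card (edges_in E (A \<union> B)) + card (edges_in E (A \<inter> B))"
    using assms by (intro add_right_mono card_mono finite_edges_in)
      (auto simp: edges_in_def)
  finally show ?thesis using c unfolding delta_def by linarith
qed

lemma sparseD:
  assumes "sparse E V" "A \<subseteq> V" "finite A"
  shows "0 \<le> delta E A" "card A < 2 ^ nat (delta E A)"
  using assms by (auto simp: sparse_def)

lemma sparse_subset: "sparse E V \<Longrightarrow> W \<subseteq> V \<Longrightarrow> sparse E W"
  by (auto simp: sparse_def)

lemma sparse_no_empty_edge: "sparse E V \<Longrightarrow> {} \<notin> E"
  using sparseD(1)[of E V "{}"] by (auto simp: delta_def edges_in_def)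

text \<open>A set of predimension 0 would have fewer than \<open>2 ^ 0\<close> points.\<close>

lemma sparse_delta_pos:
  assumes "sparse E V" "A \<subseteq> V" "finite A" "A \<noteq> {}"
  shows "1 \<le> delta E A"
proof (rule ccontr)
  assume "\<not> 1 \<le> delta E A"
  with sparseD(1)[OF assms(1-3)] have "delta E A = 0" by simp
  with sparseD(2)[OF assms(1-3)] have "card A = 0" by simp
  with assms show False by simp
qed

lemma strongD: "strong E A V \<Longrightarrow> finite B \<Longrightarrow> A \<subset> B \<Longrightarrow> B \<subseteq> V \<Longrightarrow> delta E A < delta E B"
  by (simp add: strong_def)

lemma strong_subsetD: "strong E A V \<Longrightarrow> A \<subseteq> V"
  by (simp add: strong_def)

lemma strong_leD:
  "strong E A V \<Longrightarrow> finite B \<Longrightarrow> A \<subseteq> B \<Longrightarrow> B \<subseteq> V \<Longrightarrow> delta E A \<le> delta E B"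
  unfolding strong_def by (cases "A = B") (auto simp: psubset_eq less_imp_le)

lemma strong_mono: "strong E A V \<Longrightarrow> A \<subseteq> W \<Longrightarrow> W \<subseteq> V \<Longrightarrow> strong E A W"
  unfolding strong_def by (meson subset_trans)

lemma strong_refl: "finite A \<Longrightarrow> strong E A A"
  by (auto simp: strong_def)

lemma strong_empty: "sparse E V \<Longrightarrow> strong E {} V"
  unfolding strong_def
proof (intro conjI allI impI)
  assume s: "sparse E V"
  fix B assume "finite B \<and> {} \<subset> B \<and> B \<subseteq> V"
  then have "1 \<le> delta E B" using sparse_delta_pos[OF s] by blast
  then show "delta E {} < delta E B" using delta_empty[OF sparse_no_empty_edge[OF s]] by simp
qed simp

text \<open>By submodularity the gain from \<open>X \<inter> V\<close> to \<open>X\<close> is at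
  least the gain from \<open>V\<close> to \<open>X \<union> V\<close>, which is governed by
  strongness of \<open>V\<close>.\<close>

lemma strong_Int_le:
  assumes "strong E V W" "finite V" "finite X" "X \<subseteq> W"
  shows "delta E (X \<inter> V) \<le> delta E X"
    and "\<not> X \<subseteq> V \<Longrightarrow> delta E (X \<inter> V) < delta E X"
proof -
  have s: "delta E (X \<union> V) + delta E (X \<inter> V) \<le> delta E X + delta E V"
    using assms by (intro delta_submodular)
  have W: "X \<union> V \<subseteq> W" using strong_subsetD[OF assms(1)] assms(4) by auto
  have "delta E V \<le> delta E (X \<union> V)"
    using assms W by (intro strong_leD[OF assms(1)]) auto
  with s show "delta E (X \<inter> V) \<le> delta E X" by linarith
  assume "\<not> X \<subseteq> V"
  then have "V \<subset> X \<union> V" by auto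
  then have "delta E V < delta E (X \<union> V)"
    using assms W by (intro strongD[OF assms(1)]) auto
  with s show "delta E (X \<inter> V) < delta E X" by linarith
qed

lemma strong_trans:
  assumes "strong E A V" "strong E V W" "finite V"
  shows "strong E A W"
  unfolding strong_def
proof (intro conjI allI impI)
  show "A \<subseteq> W" using assms strong_subsetD by blast
  fix B assume B: "finite B \<and> A \<subset> B \<and> B \<subseteq> W"
  show "delta E A < delta E B"
  proof (cases "B \<subseteq> V")
    case True
    then show ?thesis using strongD[OF assms(1)] B by auto
  next
    case False
    have "A \<subseteq> B \<inter> V" using B strong_subsetD[OF assms(1)] by auto
    then have "delta E A \<le> delta E (B \<inter> V)"
      using B by (intro strong_leD[OF assms(1)]) auto
    also have "\<dots> < delta E B"
      using strong_Int_le(2)[OF assms(2,3)] B False by auto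
    finally show ?thesis .
  qed
qed

text \<open>Among the finite supersets of \<open>A\<close> take those of least predimension
  \<open>d\<close>, and among these one of largest size; sparseness bounds the sizes by
  \<open>2 ^ d\<close>, so a largest one exists. Any proper finite superset then has larger
  predimension. The explicit bound follows from
  \<open>d \<le> delta E A \<le> card A\<close>.\<close>

lemma exists_strong_closure:
  assumes "sparse E X" "finite A" "A \<subseteq> X"
  obtains B where "finite B" "A \<subseteq> B" "strong E B X" "card B < 2 ^ card A"
proof -
  define P where "P = (\<lambda>B. finite B \<and> A \<subseteq> B \<and> B \<subseteq> X)"
  define d where "d = (LEAST k. \<exists>B. P B \<and> nat (delta E B) = k)"
  have PA: "P A" using assms by (simp add: P_def)
  then have "\<exists>k B. P B \<and> nat (delta E B) = k" by blast
  then have d1: "\<exists>B. P B \<and> nat (delta E B) = d"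
    unfolding d_def by (rule LeastI_ex)
  have dmin: "d \<le> nat (delta E B)" if "P B" for B
    unfolding d_def using that by (intro Least_le) blast
  obtain B0 where B0: "P B0 \<and> nat (delta E B0) = d" using d1 by blast
  have "\<forall>C. P C \<and> nat (delta E C) = d \<longrightarrow> card C < 2 ^ d"
    using sparseD(2)[OF assms(1)] by (auto simp: P_def)
  from ex_has_greatest_nat[of "\<lambda>B. P B \<and> nat (delta E B) = d" B0 card, OF B0 this]
  obtain B where B: "P B" "nat (delta E B) = d"
    and Bmax: "\<And>C. P C \<Longrightarrow> nat (delta E C) = d \<Longrightarrow> card C \<le> card B" by blast
  have nn: "0 \<le> delta E C" if "P C" for C
    using that sparseD(1)[OF assms(1)] by (auto simp: P_def)
  have "strong E B X"
    unfolding strong_def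
  proof (intro conjI allI impI)
    show "B \<subseteq> X" using B by (simp add: P_def)
    fix C assume C: "finite C \<and> B \<subset> C \<and> C \<subseteq> X"
    then have PC: "P C" using B by (auto simp: P_def)
    have "card B < card C" using C by (auto intro: psubset_card_mono)
    then have "nat (delta E C) \<noteq> d" using Bmax[OF PC] by auto
    then have "nat (delta E B) < nat (delta E C)" using dmin[OF PC] B by auto
    then show "delta E B < delta E C" by auto
  qed
  moreover have "card B < 2 ^ card A"
  proof -
    have "nat (delta E B) \<le> card A"
      using dmin[OF PA] B delta_le_card[of E A] by auto
    then have "(2::nat) ^ nat (delta E B) \<le> 2 ^ card A" by (intro power_increasing) auto
    then show ?thesis
      using sparseD(2)[OF assms(1), of B] B(1) unfolding P_def by (meson order.strict_trans2)
  qed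
  ultimately show ?thesis using that[of B] B by (auto simp: P_def)
qed

section \<open>Transport of predimension and strongness along embeddings\<close>

lemma embedsD:
  "embeds E A E' f \<Longrightarrow> inj_on f A"
  "embeds E A E' f \<Longrightarrow> e \<subseteq> A \<Longrightarrow> f ` e \<in> E' \<longleftrightarrow> e \<in> E"
  by (auto simp: embeds_def)

lemma embeds_cong:
  assumes "\<And>x. x \<in> A \<Longrightarrow> f x = g x"
  shows "embeds E A E' f \<longleftrightarrow> embeds E A E' g"
proof -
  have "f ` e = g ` e" if "e \<subseteq> A" for e using that assms by (intro image_cong) auto
  then show ?thesis unfolding embeds_def using assms by (auto cong: inj_on_cong)
qed

lemma edges_in_image:
  assumes "embeds E A E' f" "Y \<subseteq> A"
  shows "edges_in E' (f ` Y) = (`) f ` edges_in E Y"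
proof
  show "edges_in E' (f ` Y) \<subseteq> (`) f ` edges_in E Y"
  proof
    fix e assume e: "e \<in> edges_in E' (f ` Y)"
    then obtain e0 where e0: "e0 \<subseteq> Y" "e = f ` e0"
      by (auto simp: edges_in_def subset_image_iff)
    then have "e0 \<in> E" using e embedsD(2)[OF assms(1), of e0] assms(2) by (auto simp: edges_in_def)
    with e0 show "e \<in> (`) f ` edges_in E Y" by (auto simp: edges_in_def)
  qed
  show "(`) f ` edges_in E Y \<subseteq> edges_in E' (f ` Y)"
    using embedsD(2)[OF assms(1)] assms(2) by (force simp: edges_in_def)
qed

lemma delta_image:
  assumes "embeds E A E' f" "Y \<subseteq> A"
  shows "delta E' (f ` Y) = delta E Y"
proof -
  have inj: "inj_on f Y" using embedsD(1)[OF assms(1)] assms(2) inj_on_subset by blast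
  have "inj_on ((`) f) (edges_in E Y)"
  proof (rule inj_onI)
    fix e e' assume "e \<in> edges_in E Y" "e' \<in> edges_in E Y" "f ` e = f ` e'"
    then show "e = e'" using inj_on_image_eq_iff[OF inj] by (auto simp: edges_in_def)
  qed
  then show ?thesis
    unfolding delta_def edges_in_image[OF assms] by (simp add: card_image inj)
qed

lemma strong_image:
  assumes "embeds E B E' f" "A \<subseteq> B"
  shows "strong E' (f ` A) (f ` B) \<longleftrightarrow> strong E A B"
proof -
  have inj: "inj_on f B" using embedsD(1)[OF assms(1)] .
  show ?thesis
  proof
    assume s: "strong E' (f ` A) (f ` B)"
    show "strong E A B" unfolding strong_def
    proof (intro conjI allI impI assms(2))
      fix C assume C: "finite C \<and> A \<subset> C \<and> C \<subseteq> B"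
      then have "f ` A \<subset> f ` C" using inj_on_image_eq_iff[OF inj, of A C] by auto
      then have "delta E' (f ` A) < delta E' (f ` C)"
        using C by (intro strongD[OF s]) auto
      then show "delta E A < delta E C"
        using delta_image[OF assms(1)] C assms(2) by auto
    qed
  next
    assume s: "strong E A B"
    show "strong E' (f ` A) (f ` B)" unfolding strong_def
    proof (intro conjI allI impI)
      show "f ` A \<subseteq> f ` B" using assms(2) by auto
      fix D assume D: "finite D \<and> f ` A \<subset> D \<and> D \<subseteq> f ` B"
      define C where "C = {x \<in> B. f x \<in> D}"
      have DC: "D = f ` C" using D by (auto simp: C_def)
      have "inj_on f C" using inj by (rule inj_on_subset) (auto simp: C_def)
      then have "finite C" using D finite_imageD[of f C] DC by metis
      moreover have "A \<subset> C" using D assms(2) by (auto simp: C_def)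
      moreover have "C \<subseteq> B" by (auto simp: C_def)
      ultimately have "delta E A < delta E C" by (intro strongD[OF s])
      then show "delta E' (f ` A) < delta E' D"
        using delta_image[OF assms(1)] \<open>C \<subseteq> B\<close> assms(2) by (simp add: DC)
    qed
  qed
qed

lemma embeds_comp:
  assumes "embeds E A E' f" "embeds E' B E'' g" "f ` A \<subseteq> B"
  shows "embeds E A E'' (g \<circ> f)"
  unfolding embeds_def
proof (intro conjI allI impI)
  show "inj_on (g \<circ> f) A"
    using embedsD(1)[OF assms(1)] inj_on_subset[OF embedsD(1)[OF assms(2)] assms(3)]
    by (rule comp_inj_on)
  fix e assume e: "e \<subseteq> A"
  then have "f ` e \<subseteq> B" using assms(3) by auto
  then show "(g \<circ> f) ` e \<in> E'' \<longleftrightarrow> e \<in> E"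
    using embedsD(2)[OF assms(1) e] embedsD(2)[OF assms(2), of "f ` e"] by (simp add: image_comp)
qed

lemma embeds_inv:
  assumes "embeds E A E' f"
  shows "embeds E' (f ` A) E (inv_into A f)"
  unfolding embeds_def
proof (intro conjI allI impI)
  show "inj_on (inv_into A f) (f ` A)" by (rule inj_on_inv_into) simp
  fix e assume "e \<subseteq> f ` A"
  then obtain e0 where e0: "e0 \<subseteq> A" "e = f ` e0" by (auto simp: subset_image_iff)
  have "inv_into A f ` e = e0" using e0 embedsD(1)[OF assms] by (simp add: inv_into_image_cancel)
  then show "inv_into A f ` e \<in> E \<longleftrightarrow> e \<in> E'" using embedsD(2)[OF assms e0(1)] e0 by simp
qed

lemma embeds_restrict_edges:
  assumes "\<And>e. e \<subseteq> f ` A \<Longrightarrow> e \<in> E' \<longleftrightarrow> e \<in> E''"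
  shows "embeds E A E' f \<longleftrightarrow> embeds E A E'' f"
proof -
  have "f ` e \<in> E' \<longleftrightarrow> f ` e \<in> E''" if "e \<subseteq> A" for e using assms that by (simp add: image_mono)
  then show ?thesis by (auto simp: embeds_def)
qed

section \<open>Free amalgamation and the generic hypergraph\<close>

lemma edges_in_cong: "(\<And>e. e \<subseteq> V \<Longrightarrow> e \<in> E \<longleftrightarrow> e \<in> E') \<Longrightarrow> edges_in E V = edges_in E' V"
  by (auto simp: edges_in_def)

lemma delta_cong:
  assumes "\<And>e. e \<subseteq> V \<Longrightarrow> e \<in> E \<longleftrightarrow> e \<in> E'"
  shows "delta E V = delta E' V"
  unfolding delta_def using edges_in_cong[OF assms] by simp

lemma delta_cong_subset:
  assumes "\<And>e. e \<subseteq> V \<Longrightarrow> e \<in> E \<longleftrightarrow> e \<in> E'" "A \<subseteq> V"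
  shows "delta E A = delta E' A"
  by (rule delta_cong) (use assms in blast)

lemma strong_cong:
  assumes "\<And>e. e \<subseteq> V \<Longrightarrow> e \<in> E \<longleftrightarrow> e \<in> E'"
  shows "strong E A V \<longleftrightarrow> strong E' A V"
  unfolding strong_def using delta_cong_subset[of V E E', OF assms]
  by (metis (no_types, lifting))

lemma sparse_cong:
  assumes "\<And>e. e \<subseteq> V \<Longrightarrow> e \<in> E \<longleftrightarrow> e \<in> E'"
  shows "sparse E V \<longleftrightarrow> sparse E' V"
  unfolding sparse_def using delta_cong_subset[of V E E', OF assms]
  by (metis (no_types, lifting))

lemma embeds_cong_edges:
  assumes "\<And>e. e \<subseteq> A \<Longrightarrow> e \<in> E \<longleftrightarrow> e \<in> E'"
  shows "embeds E A F f \<longleftrightarrow> embeds E' A F f"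
  unfolding embeds_def using assms by blast

lemma sparse_image:
  assumes "embeds E B E' f" "sparse E B"
  shows "sparse E' (f ` B)"
  unfolding sparse_def
proof (intro allI impI)
  fix D assume D: "D \<subseteq> f ` B" "finite D"
  then obtain C where C: "C \<subseteq> B" "D = f ` C" by (auto simp: subset_image_iff)
  have inj: "inj_on f C" using embedsD(1)[OF assms(1)] C(1) by (rule inj_on_subset)
  then have "finite C" using D C finite_imageD by blast
  then show "0 \<le> delta E' D \<and> card D < 2 ^ nat (delta E' D)"
    using sparseD[OF assms(2) C(1)] delta_image[OF assms(1) C(1)] C(2) card_image[OF inj] by simp
qed

text \<open>The two factors are placed so that their common part is exactly
  \<open>V \<inter> W\<close>; the free amalgam is then simply the union of vertex sets and of edge
  sets.\<close>

locale amalgam =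
  fixes V W :: "'a set" and E F :: "'a set set"
  assumes fin: "finite V" "finite W"
    and edges: "E \<subseteq> Pow V" "F \<subseteq> Pow W"
    and agree: "\<And>e. e \<subseteq> V \<inter> W \<Longrightarrow> e \<in> E \<longleftrightarrow> e \<in> F"
    and sparse: "sparse E V" "sparse F W"
    and strong: "strong E (V \<inter> W) V" "strong F (V \<inter> W) W"
begin

lemma edges_left:
  assumes "e \<subseteq> V"
  shows "e \<in> E \<union> F \<longleftrightarrow> e \<in> E"
proof -
  have "e \<subseteq> V \<inter> W" if "e \<in> F" using that edges(2) assms by auto
  then show ?thesis using agree[of e] by (metis Un_iff)
qed

lemma edges_right:
  assumes "e \<subseteq> W"
  shows "e \<in> E \<union> F \<longleftrightarrow> e \<in> F"
proof -
  have "e \<subseteq> V \<inter> W" if "e \<in> E" using that edges(1) assms by auto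
  then show ?thesis using agree[of e] by (metis Un_iff)
qed

text \<open>No edge crosses between the two sides, and an edge belonging to both lies in
  \<open>V \<inter> W\<close>. Inclusion-exclusion is therefore exact for vertices and for
  edges.\<close>

lemma delta_amalgam:
  assumes X: "X \<subseteq> V \<union> W"
  shows "delta (E \<union> F) X = delta E (X \<inter> V) + delta F (X \<inter> W) - delta E (X \<inter> (V \<inter> W))"
proof -
  have fX: "finite X" using X fin by (auto intro: finite_subset)
  have un: "edges_in (E \<union> F) X = edges_in E (X \<inter> V) \<union> edges_in F (X \<inter> W)"
    using edges by (auto simp: edges_in_def)
  have int: "edges_in E (X \<inter> V) \<inter> edges_in F (X \<inter> W) = edges_in E (X \<inter> (V \<inter> W))"
    using agree by (auto simp: edges_in_def)
  have 1: "card (edges_in E (X \<inter> V)) + card (edges_in F (X \<inter> W))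
      = card (edges_in (E \<union> F) X) + card (edges_in E (X \<inter> (V \<inter> W)))"
    unfolding un int[symmetric] using fX by (intro card_Un_Int finite_edges_in) auto
  have "(X \<inter> V) \<union> (X \<inter> W) = X" "(X \<inter> V) \<inter> (X \<inter> W) = X \<inter> (V \<inter> W)" using X by auto
  then have 2: "card (X \<inter> V) + card (X \<inter> W) = card X + card (X \<inter> (V \<inter> W))"
    using card_Un_Int[of "X \<inter> V" "X \<inter> W"] fX by simp
  show ?thesis using 1 2 unfolding delta_def by linarith
qed

lemma swap: "amalgam W V F E"
  using fin edges agree sparse strong by unfold_locales (auto simp: Int_commute)

text \<open>The gain of \<open>X\<close> over \<open>V\<close> equals the gain of
  \<open>X \<inter> W\<close> over \<open>V \<inter> W\<close> in the other factor.\<close>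

lemma strong_left: "strong (E \<union> F) V (V \<union> W)"
  unfolding strong_def
proof (intro conjI allI impI)
  fix X assume X: "finite X \<and> V \<subset> X \<and> X \<subseteq> V \<union> W"
  have "delta E (V \<inter> W) < delta F (X \<inter> W)"
    using strongD[OF strong(2), of "X \<inter> W"] X
      delta_cong[of "V \<inter> W" E F] agree by auto
  moreover have "X \<inter> V = V" "X \<inter> (V \<inter> W) = V \<inter> W" using X by auto
  moreover have "delta (E \<union> F) V = delta E V"
    by (rule delta_cong) (simp add: edges_left del: Un_iff)
  ultimately show "delta (E \<union> F) V < delta (E \<union> F) X" using delta_amalgam[of X] X by auto
qed auto

lemma strong_right: "strong (E \<union> F) W (V \<union> W)"
  using amalgam.strong_left[OF swap] by (simp add: Un_commute)

text \<open>A set inside one factor inherits the bound. Otherwise both halves properly extend the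
  common part, and two sizes below \<open>2 ^ k\<close> sum to one below
  \<open>2 ^ (k + 1)\<close>.\<close>

lemma sparse_amalgam: "sparse (E \<union> F) (V \<union> W)"
  unfolding sparse_def
proof (intro allI impI)
  fix X assume X: "X \<subseteq> V \<union> W" "finite X"
  let ?X1 = "X \<inter> V" and ?X2 = "X \<inter> W" and ?X0 = "X \<inter> (V \<inter> W)"
  note d = delta_amalgam[OF X(1)]
  have d0: "delta F ?X0 = delta E ?X0" by (rule delta_cong) (use agree in blast)
  note s1 = sparseD[OF sparse(1), of ?X1] and s2 = sparseD[OF sparse(2), of ?X2]
  show "0 \<le> delta (E \<union> F) X \<and> card X < 2 ^ nat (delta (E \<union> F) X)"
  proof (cases "?X1 = ?X0 \<or> ?X2 = ?X0")
    case True
    then show ?thesis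
    proof
      assume a: "?X1 = ?X0"
      then have x: "?X2 = X" "X \<subseteq> W" using X by auto
      have "delta (E \<union> F) X = delta F X" using d by (simp add: a x)
      then show ?thesis using s2 X x by simp
    next
      assume a: "?X2 = ?X0"
      then have x: "?X1 = X" "X \<subseteq> V" using X by auto
      have "delta (E \<union> F) X = delta E X" using d d0 by (simp add: a x)
      then show ?thesis using s1 X x by simp
    qed
  next
    case False
    have "delta E (?X1 \<inter> (V \<inter> W)) < delta E ?X1"
      using X False fin by (intro strong_Int_le(2)[OF strong(1)]) auto
    moreover have "?X1 \<inter> (V \<inter> W) = ?X0" by auto
    ultimately have l1: "delta E ?X0 < delta E ?X1" by simp
    have "delta F (?X2 \<inter> (V \<inter> W)) < delta F ?X2"
      using X False fin by (intro strong_Int_le(2)[OF strong(2)]) auto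
    moreover have "?X2 \<inter> (V \<inter> W) = ?X0" by auto
    ultimately have l2: "delta E ?X0 < delta F ?X2" using d0 by simp
    \<comment> \<open>By \<open>delta_amalgam\<close> each half has the predimension of
      \<open>X\<close> minus the gain of the other half, and this gain is at least 1 by
      \<open>l1\<close> and \<open>l2\<close>; hence both halves are bounded by
      \<open>k\<close>.\<close>
    define k where "k = nat (delta (E \<union> F) X) - 1"
    have k: "delta (E \<union> F) X = int k + 1" "delta E ?X1 \<le> int k" "delta F ?X2 \<le> int k"
      using l1 l2 d s1 s2 X unfolding k_def by auto
    have "card ?X1 < 2 ^ k"
      using s1 X k(2) by (smt (verit) Int_lower2 finite_Int nat_le_iff one_le_numeral
          order_less_le_trans power_increasing)
    moreover have "card ?X2 < 2 ^ k"
      using s2 X k(3) by (smt (verit) Int_lower2 finite_Int nat_le_iff one_le_numeral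
          order_less_le_trans power_increasing)
    moreover have "card X \<le> card ?X1 + card ?X2"
      using card_Un_le[of ?X1 ?X2] X by (simp add: Int_Un_distrib[symmetric] Int_absorb2)
    moreover have "nat (int k + 1) = Suc k" by simp
    ultimately show ?thesis unfolding k(1) by simp
  qed
qed

end

definition extends :: "nat set \<times> nat set set \<Rightarrow> nat set \<times> nat set set \<Rightarrow> bool" where
  "extends S S' \<longleftrightarrow> fst S \<subseteq> fst S' \<and> strong (snd S') (fst S) (fst S') \<and>
     (\<forall>e\<subseteq>fst S. e \<in> snd S' \<longleftrightarrow> e \<in> snd S)"

definition finite_sparse :: "nat set \<times> nat set set \<Rightarrow> bool" where
  "finite_sparse S \<longleftrightarrow> finite (fst S) \<and> snd S \<subseteq> Pow (fst S) \<and> sparse (snd S) (fst S)"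

text \<open>An abstract strong extension \<open>B\<close> of \<open>A\<close> is realised over a
  given strong copy of \<open>A\<close> in \<open>V\<close> by gluing a fresh copy of
  \<open>B\<close> to \<open>V\<close> along that copy.\<close>

lemma amalgamation_step:
  fixes p :: "nat \<Rightarrow> nat"
  assumes S: "finite_sparse (V, E)"
    and B: "finite B" "A \<subseteq> B" "strong ES A B" "sparse ES B"
    and p: "embeds ES A E p" "strong E (p ` A) V"
  obtains S' f where "finite_sparse S'" "extends (V, E) S'"
    "\<And>x. x \<in> A \<Longrightarrow> f x = p x" "embeds ES B (snd S') f" "strong (snd S') (f ` B) (fst S')"
proof -
  have V: "finite V" "E \<subseteq> Pow V" "sparse E V" using S by (auto simp: finite_sparse_def)
  obtain N where N: "V \<subseteq> {..<N}" using finite_nat_iff_bounded V(1) by blast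
  have pA: "p ` A \<subseteq> V" using p(2) by (rule strong_subsetD)
  \<comment> \<open>All elements of \<open>V\<close> are below \<open>N\<close>, so the points
    \<open>N + x\<close> are fresh and the copy of \<open>B\<close> meets \<open>V\<close> only in
    the image of \<open>A\<close>.\<close>
  define f where "f = (\<lambda>x. if x \<in> A then p x else N + x)"
  have fA: "f ` A = p ` A" by (auto simp: f_def)
  have new: "f x \<notin> V" if "x \<in> B" "x \<notin> A" for x using that N by (auto simp: f_def)
  have inj: "inj_on f B"
  proof (rule inj_onI)
    fix x y assume xy: "x \<in> B" "y \<in> B" "f x = f y"
    have A: "z \<in> A \<longleftrightarrow> f z \<in> V" if "z \<in> B" for z
      using new[of z] that fA pA by blast
    show "x = y"
    proof (cases "x \<in> A")
      case True
      then have "y \<in> A" using A[of x] A[of y] xy by simp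
      then show ?thesis using True xy(3) inj_onD[OF embedsD(1)[OF p(1)]] by (auto simp: f_def)
    next
      case False
      then have "y \<notin> A" using A[of x] A[of y] xy by simp
      then show ?thesis using False xy(3) by (auto simp: f_def)
    qed
  qed
  define F where "F = (`) f ` edges_in ES B"
  have emb: "embeds ES B F f"
    unfolding embeds_def
  proof (intro conjI allI impI inj)
    fix e assume e: "e \<subseteq> B"
    have "e' = e" if "f ` e = f ` e'" "e' \<subseteq> B" for e'
      using inj_on_image_eq_iff[OF inj e that(2)] that(1) by simp
    then show "f ` e \<in> F \<longleftrightarrow> e \<in> ES" using e by (auto simp: F_def edges_in_def)
  qed
  have int: "V \<inter> f ` B = f ` A" using new fA pA B(2) by blast
  have agree: "e \<in> E \<longleftrightarrow> e \<in> F" if sub: "e \<subseteq> V \<inter> f ` B" for e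
  proof -
    obtain e0 where e0: "e0 \<subseteq> A" "e = f ` e0" using sub int by (auto simp: subset_image_iff)
    have "f ` e0 = p ` e0" using e0(1) by (auto simp: f_def)
    then show ?thesis
      using embedsD(2)[OF p(1) e0(1)] embedsD(2)[OF emb, of e0] e0 B(2) by auto
  qed
  interpret amalgam V "f ` B" E F
  proof
    show "finite V" "finite (f ` B)" using V B by auto
    show "E \<subseteq> Pow V" "F \<subseteq> Pow (f ` B)" using V(2) by (auto simp: F_def edges_in_def)
    show "sparse E V" "sparse F (f ` B)" using V(3) sparse_image[OF emb B(4)] by auto
    show "strong E (V \<inter> f ` B) V" using p(2) by (simp add: int fA)
    show "strong F (V \<inter> f ` B) (f ` B)" using strong_image[OF emb B(2)] B(3) by (simp add: int)
  qed (rule agree)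
  let ?S = "(V \<union> f ` B, E \<union> F)"
  show ?thesis
  proof (rule that)
    show "finite_sparse ?S"
      unfolding finite_sparse_def using fin edges sparse_amalgam by auto
    show "extends (V, E) ?S"
      unfolding extends_def using strong_left edges_left by auto
    show "f x = p x" if "x \<in> A" for x using that by (simp add: f_def)
    show "embeds ES B (snd ?S) f"
      using embeds_restrict_edges[of f B F "E \<union> F" ES] edges_right emb by simp
    show "strong (snd ?S) (f ` B) (fst ?S)" using strong_right by simp
  qed
qed

section \<open>Bookkeeping for the chain of finite hypergraphs\<close>

lemma extends_refl: "finite (fst S) \<Longrightarrow> extends S S"
  by (simp add: extends_def strong_refl)

lemma extends_trans:
  assumes "extends S T" "extends T U" "finite (fst T)"
  shows "extends S U"
proof -
  have "strong (snd U) (fst S) (fst T)"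
    using strong_cong[of "fst T" "snd T" "snd U" "fst S"] assms by (auto simp: extends_def)
  then have "strong (snd U) (fst S) (fst U)"
    using strong_trans[of "snd U" "fst S" "fst T" "fst U"] assms by (auto simp: extends_def)
  moreover have "\<forall>e\<subseteq>fst S. e \<in> snd U \<longleftrightarrow> e \<in> snd S"
    using assms unfolding extends_def by (meson subset_trans)
  ultimately show ?thesis using assms by (auto simp: extends_def)
qed


type_synonym task = "nat set \<times> nat set \<times> nat set set \<times> (nat \<Rightarrow> nat)"

text \<open>A task \<open>(B, A, ES, p)\<close> asks to extend \<open>p\<close> from
  \<open>A\<close> to \<open>B\<close>, where \<open>ES\<close> gives the edges on \<open>B\<close>.
  Keeping the edges inside \<open>B\<close> and \<open>p\<close> extensional leaves only countably
  many tasks.\<close>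

definition tasks :: "task set" where
  "tasks = (SIGMA B:{B. finite B}. SIGMA A:Pow B. Pow (Pow B) \<times> (A \<rightarrow>\<^sub>E UNIV))"

lemma countable_tasks: "countable tasks"
  unfolding tasks_def
proof (intro countable_SIGMA)
  show "countable {B::nat set. finite B}" by (rule countable_Collect_finite)
  fix B :: "nat set" assume B: "B \<in> {B. finite B}"
  then show "countable (Pow B)" by (auto intro: countable_finite)
  fix A assume "A \<in> Pow B"
  then have "finite A" using B finite_subset by auto
  then show "countable (A \<rightarrow>\<^sub>E (UNIV :: nat set))" by (intro countable_PiE) auto
  show "countable (Pow (Pow B))" using B by (auto intro: countable_finite)
qed

definition solved :: "task \<Rightarrow> nat set \<times> nat set set \<Rightarrow> bool" where
  "solved t S \<longleftrightarrow> (case t of (B, A, ES, p) \<Rightarrow>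
     \<exists>f. (\<forall>x\<in>A. f x = p x) \<and> embeds ES B (snd S) f \<and> strong (snd S) (f ` B) (fst S))"

definition applicable :: "task \<Rightarrow> nat set \<times> nat set set \<Rightarrow> bool" where
  "applicable t S \<longleftrightarrow> (case t of (B, A, ES, p) \<Rightarrow>
     finite B \<and> A \<subseteq> B \<and> strong ES A B \<and> sparse ES B \<and>
     embeds ES A (snd S) p \<and> strong (snd S) (p ` A) (fst S))"

lemma task_step:
  assumes "finite_sparse S"
  shows "\<exists>S'. finite_sparse S' \<and> extends S S' \<and> (applicable t S \<longrightarrow> solved t S')"
proof (cases "applicable t S")
  case True
  obtain B A ES p where t: "t = (B, A, ES, p)" by (cases t)
  obtain V E where S: "S = (V, E)" by (cases S)
  from True have a: "finite B" "A \<subseteq> B" "strong ES A B" "sparse ES B"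
    "embeds ES A E p" "strong E (p ` A) V" by (auto simp: applicable_def t S)
  from amalgamation_step[OF assms[unfolded S] a]
  obtain S' f where "finite_sparse S'" "extends (V, E) S'"
    "\<And>x. x \<in> A \<Longrightarrow> f x = p x" "embeds ES B (snd S') f" "strong (snd S') (f ` B) (fst S')"
    by blast
  then show ?thesis unfolding solved_def t S by (intro exI[of _ S']) auto
next
  case False
  then show ?thesis
    using assms extends_refl[of S] unfolding finite_sparse_def by (intro exI[of _ S]) simp
qed

text \<open>\<open>extension\<close> is the richness property of a Fraisse limit with respect to
  strong embeddings; it is the source of homogeneity and of every concrete configuration found
  later.\<close>

locale generic_structure =
  fixes X :: "nat set" and E :: "nat set set"
  assumes edge: "\<And>e. e \<in> E \<Longrightarrow> finite e \<and> e \<subseteq> X"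
    and sparse: "sparse E X"
    and extension:
      "\<And>(B :: nat set) A ES p. \<lbrakk>finite B; A \<subseteq> B; strong ES A B; sparse ES B; embeds ES A E p; strong E (p ` A) X\<rbrakk>
       \<Longrightarrow> \<exists>f. (\<forall>x\<in>A. f x = p x) \<and> embeds ES B E f \<and> strong E (f ` B) X"

theorem generic_structure_exists: "\<exists>X E. generic_structure X E"
proof -
  \<comment> \<open>The second component of the decoded pair is a free counter, so every task is
    scheduled at arbitrarily late stages.\<close>
  define T where "T = (\<lambda>n. from_nat_into tasks (fst (prod_decode n)))"
  have "\<exists>S. \<forall>n. finite_sparse (S n) \<and> extends (S n) (S (Suc n)) \<and>
          (applicable (T n) (S n) \<longrightarrow> solved (T n) (S (Suc n)))"
    (is "\<exists>S. \<forall>n. ?P S n")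
  proof -
    have "\<exists>S. \<forall>n. finite_sparse (S n) \<and> (extends (S n) (S (Suc n)) \<and>
          (applicable (T n) (S n) \<longrightarrow> solved (T n) (S (Suc n))))"
    proof (rule dependent_nat_choice)
      show "\<exists>S. finite_sparse S"
        by (rule exI[of _ "({}, {})"])
          (simp add: finite_sparse_def sparse_def delta_def edges_in_def)
    next
      fix S n assume "finite_sparse S"
      then show "\<exists>S'. finite_sparse S' \<and>
          (extends S S' \<and> (applicable (T n) S \<longrightarrow> solved (T n) S'))"
        using task_step by blast
    qed
    then show ?thesis by blast
  qed
  then obtain S where fs: "\<And>n. finite_sparse (S n)"
    and ext: "\<And>n. extends (S n) (S (Suc n))"
    and solve: "\<And>n. applicable (T n) (S n) \<Longrightarrow> solved (T n) (S (Suc n))" by blast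
  have ext_le: "extends (S m) (S n)" if "m \<le> n" for m n
    using that
  proof (induction n rule: dec_induct)
    case base
    show ?case using fs[of m] by (intro extends_refl) (simp add: finite_sparse_def)
  next
    case (step k)
    show ?case
      using extends_trans[OF step.IH ext] fs[of k] by (simp add: finite_sparse_def)
  qed
  define X where "X = (\<Union>n. fst (S n))"
  define E where "E = (\<Union>n. snd (S n))"
  have mono: "fst (S m) \<subseteq> fst (S n)" if "m \<le> n" for m n
    using ext_le[OF that] by (simp add: extends_def)
  have edge_iff: "e \<in> E \<longleftrightarrow> e \<in> snd (S n)" if e: "e \<subseteq> fst (S n)" for e n
  proof
    assume "e \<in> E"
    then obtain m where m: "e \<in> snd (S m)" by (auto simp: E_def)
    then have em: "e \<subseteq> fst (S m)" using fs[of m] by (auto simp: finite_sparse_def)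
    show "e \<in> snd (S n)"
    proof (cases "m \<le> n")
      case True
      then show ?thesis using ext_le[OF True] em m by (auto simp: extends_def)
    next
      case False
      then have "extends (S n) (S m)" by (intro ext_le) simp
      then show ?thesis using e m by (auto simp: extends_def)
    qed
  qed (auto simp: E_def)
  have cover: "\<exists>n. A \<subseteq> fst (S n)" if "finite A" "A \<subseteq> X" for A
    using that
  proof (induction A)
    case (insert x A)
    then obtain n m where "A \<subseteq> fst (S n)" "x \<in> fst (S m)" by (auto simp: X_def)
    then have "insert x A \<subseteq> fst (S (max n m))"
      using mono[of n "max n m"] mono[of m "max n m"] by auto
    then show ?case by blast
  qed simp
  \<comment> \<open>A finite superset of a stage already lies in some later stage, in which the
    earlier one is strong.\<close>
  have strong_stage: "strong E (fst (S n)) X" for n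
    unfolding strong_def
  proof (intro conjI allI impI)
    fix B assume B: "finite B \<and> fst (S n) \<subset> B \<and> B \<subseteq> X"
    then obtain m where m: "B \<subseteq> fst (S m)" using cover by blast
    then have m': "B \<subseteq> fst (S (max n m))" using mono[of m "max n m"] by auto
    have "extends (S n) (S (max n m))" by (intro ext_le) simp
    then have "strong (snd (S (max n m))) (fst (S n)) (fst (S (max n m)))"
      by (simp add: extends_def)
    then have "strong E (fst (S n)) (fst (S (max n m)))"
      using strong_cong[of "fst (S (max n m))" E "snd (S (max n m))"] edge_iff by blast
    then show "delta E (fst (S n)) < delta E B" using B m' by (intro strongD) auto
  qed (auto simp: X_def)
  have "generic_structure X E"
  proof
    fix e assume "e \<in> E"
    then obtain n where n: "e \<in> snd (S n)" by (auto simp: E_def)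
    then have "e \<subseteq> fst (S n)" "finite (fst (S n))" using fs[of n] by (auto simp: finite_sparse_def)
    then show "finite e \<and> e \<subseteq> X" by (auto simp: X_def intro: finite_subset)
  next
    show "sparse E X"
      unfolding sparse_def
    proof (intro allI impI)
      fix A assume A: "A \<subseteq> X" "finite A"
      then obtain n where n: "A \<subseteq> fst (S n)" using cover by blast
      have "delta E A = delta (snd (S n)) A"
        by (rule delta_cong) (use edge_iff n in blast)
      then show "0 \<le> delta E A \<and> card A < 2 ^ nat (delta E A)"
        using fs[of n] sparseD[of "snd (S n)" "fst (S n)" A] n A by (simp add: finite_sparse_def)
    qed
  next
    fix A B :: "nat set" and ES p
    assume B: "finite B" "A \<subseteq> B" "strong ES A B" "sparse ES B"
      and p: "embeds ES A E p" "strong E (p ` A) X"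
    \<comment> \<open>The given extension problem is replaced by its normalised version, which is an
      element of \<open>tasks\<close>.\<close>
    define q where "q = restrict p A"
    define ES' where "ES' = edges_in ES B"
    have ES': "e \<in> ES \<longleftrightarrow> e \<in> ES'" if "e \<subseteq> B" for e using that by (simp add: ES'_def edges_in_def)
    have qA: "q ` A = p ` A" by (simp add: q_def)
    have q: "embeds ES' A E q"
      using p(1) embeds_cong[of A p q ES E] embeds_cong_edges[of A ES ES' E q] ES' B(2)
      by (auto simp: q_def)
    have t: "(B, A, ES', q) \<in> tasks"
      using B unfolding tasks_def by (auto simp: ES'_def edges_in_def q_def)
    have fA: "finite (p ` A)" using B finite_subset by auto
    obtain m where m: "p ` A \<subseteq> fst (S m)" using cover[OF fA] strong_subsetD[OF p(2)] by blast
    \<comment> \<open>The counter is set to \<open>m\<close>, which gives \<open>m \<le> n\<close>: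
      when the task comes up, the image of \<open>A\<close> is already present.\<close>
    define n where "n = prod_encode (to_nat_on tasks (B, A, ES', q), m)"
    have Tn: "T n = (B, A, ES', q)"
      unfolding T_def n_def using t countable_tasks by simp
    have "m \<le> n" unfolding n_def by (rule le_prod_encode_2)
    then have n: "p ` A \<subseteq> fst (S n)" using m mono by blast
    have en: "e \<in> E \<longleftrightarrow> e \<in> snd (S n)" if "e \<subseteq> fst (S n)" for e using edge_iff[OF that] .
    have "applicable (T n) (S n)"
      unfolding applicable_def Tn
    proof (simp add: B, intro conjI)
      show "strong ES' A B" using B(3) strong_cong[OF ES'] by blast
      show "sparse ES' B" using B(4) sparse_cong[OF ES'] by blast
      show "embeds ES' A (snd (S n)) q"
        using q embeds_restrict_edges[of q A E "snd (S n)" ES'] en n qA by (metis subset_trans)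
      have "strong E (p ` A) (fst (S n))"
        using strong_mono[OF p(2) n] by (auto simp: X_def)
      then show "strong (snd (S n)) (q ` A) (fst (S n))"
        unfolding qA using strong_cong[OF en] by blast
    qed
    from solve[OF this] obtain f where f: "\<forall>x\<in>A. f x = q x" "embeds ES' B (snd (S (Suc n))) f"
      "strong (snd (S (Suc n))) (f ` B) (fst (S (Suc n)))"
      by (auto simp: solved_def Tn)
    have en': "e \<in> E \<longleftrightarrow> e \<in> snd (S (Suc n))" if "e \<subseteq> fst (S (Suc n))" for e
      using edge_iff[OF that] .
    have "f ` B \<subseteq> fst (S (Suc n))" using f(3) by (rule strong_subsetD)
    then have "embeds ES' B E f"
      using f(2) embeds_restrict_edges[of f B E "snd (S (Suc n))" ES'] en' by (metis subset_trans)
    then have 1: "embeds ES B E f" using embeds_cong_edges[of B ES ES' E f] ES' by blast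
    have "strong E (f ` B) (fst (S (Suc n)))" using f(3) strong_cong[OF en'] by blast
    moreover have "finite (fst (S (Suc n)))" using fs[of "Suc n"] by (simp add: finite_sparse_def)
    ultimately have 2: "strong E (f ` B) X" using strong_stage[of "Suc n"] strong_trans by blast
    show "\<exists>f. (\<forall>x\<in>A. f x = p x) \<and> embeds ES B E f \<and> strong E (f ` B) X"
      using 1 2 f(1) by (intro exI[of _ f]) (auto simp: q_def)
  qed
  then show ?thesis by blast
qed

section \<open>Homogeneity and oligomorphy\<close>

text \<open>Openness by finite windows; it serves both for permutations of \<open>X\<close> and for
  the cube that carries the orientations.\<close>

lemma openin_product_discrete_iff:
  "openin (product_topology (\<lambda>_. discrete_topology A) I) U \<longleftrightarrow>
     U \<subseteq> (I \<rightarrow>\<^sub>E A) \<and>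
     (\<forall>f\<in>U. \<exists>J. finite J \<and> J \<subseteq> I \<and> (\<forall>g\<in>I \<rightarrow>\<^sub>E A. (\<forall>j\<in>J. g j = f j) \<longrightarrow> g \<in> U))"
    (is "?open \<longleftrightarrow> ?sub \<and> ?fin")
proof (intro iffI conjI)
  assume o: ?open
  then show ?sub using openin_subset[OF o] by simp
  show ?fin
  proof
    fix f assume "f \<in> U"
    then obtain W where W: "finite {i \<in> I. W i \<noteq> topspace (discrete_topology A)}"
      "f \<in> Pi\<^sub>E I W" "Pi\<^sub>E I W \<subseteq> U"
      using o unfolding openin_product_topology_alt by blast
    let ?J = "{i \<in> I. W i \<noteq> A}"
    have "g \<in> U" if g: "g \<in> I \<rightarrow>\<^sub>E A" "\<forall>j\<in>?J. g j = f j" for g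
    proof -
      have "g i \<in> W i" if "i \<in> I" for i
        using g W(2) that by (cases "W i = A") (auto simp: PiE_iff)
      then have "g \<in> Pi\<^sub>E I W" using g(1) by (auto simp: PiE_iff)
      then show ?thesis using W(3) by blast
    qed
    then show "\<exists>J. finite J \<and> J \<subseteq> I \<and> (\<forall>g\<in>I \<rightarrow>\<^sub>E A. (\<forall>j\<in>J. g j = f j) \<longrightarrow> g \<in> U)"
      using W(1) by (intro exI[of _ ?J]) auto
  qed
next
  assume h: "?sub \<and> ?fin"
  show ?open
    unfolding openin_product_topology_alt
  proof
    fix f assume f: "f \<in> U"
    then obtain J where J: "finite J" "J \<subseteq> I" "\<forall>g\<in>I \<rightarrow>\<^sub>E A. (\<forall>j\<in>J. g j = f j) \<longrightarrow> g \<in> U"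
      using h by blast
    have fA: "f \<in> I \<rightarrow>\<^sub>E A" using h f by blast
    define W where "W = (\<lambda>i. if i \<in> J then {f i} else A)"
    have "finite {i \<in> I. W i \<noteq> topspace (discrete_topology A)}"
      by (rule finite_subset[OF _ J(1)]) (auto simp: W_def)
    moreover have "\<forall>i\<in>I. openin (discrete_topology A) (W i)"
      using fA by (auto simp: W_def PiE_iff)
    moreover have "f \<in> Pi\<^sub>E I W" using fA by (auto simp: W_def PiE_iff)
    moreover have "Pi\<^sub>E I W \<subseteq> U"
    proof
      fix g assume g: "g \<in> Pi\<^sub>E I W"
      have "g i \<in> A" if "i \<in> I" for i
        using PiE_mem[OF g that] PiE_mem[OF fA that] by (auto simp: W_def split: if_splits)
      then have "g \<in> I \<rightarrow>\<^sub>E A" using g by (auto simp: PiE_iff)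
      moreover have "\<forall>j\<in>J. g j = f j" using g J(2) by (force simp: W_def PiE_iff)
      ultimately show "g \<in> U" using J(3) by blast
    qed
    ultimately show "\<exists>W. finite {i \<in> I. W i \<noteq> topspace (discrete_topology A)} \<and>
        (\<forall>i\<in>I. openin (discrete_topology A) (W i)) \<and> f \<in> Pi\<^sub>E I W \<and> Pi\<^sub>E I W \<subseteq> U" by blast
  qed
qed

lemma carrier_permgroup [simp]: "carrier (permgroup G X) = G"
  by (simp add: permgroup_def)

lemma BijD: "f \<in> Bij X \<Longrightarrow> bij_betw f X X" "f \<in> Bij X \<Longrightarrow> f \<in> extensional X"
  by (auto simp: Bij_def)

context generic_structure
begin

text \<open>Edges are finite, so finite sets \<open>e\<close> suffice as tests. A failure then shows
  on finitely many points, and this makes \<open>aut\<close> closed.\<close>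

definition aut :: "(nat \<Rightarrow> nat) set" where
  "aut = {g \<in> Bij X. \<forall>e. finite e \<longrightarrow> e \<subseteq> X \<longrightarrow> (g ` e \<in> E \<longleftrightarrow> e \<in> E)}"

definition partial_iso :: "nat set \<Rightarrow> (nat \<Rightarrow> nat) \<Rightarrow> bool" where
  "partial_iso A f \<longleftrightarrow> finite A \<and> strong E A X \<and> embeds E A E f \<and> strong E (f ` A) X"

lemma partial_iso_inv:
  assumes "partial_iso A f"
  shows "partial_iso (f ` A) (inv_into A f)"
proof -
  have "inj_on f A" using assms embedsD(1) unfolding partial_iso_def by blast
  then have "inv_into A f ` f ` A = A" by simp
  then show ?thesis using assms embeds_inv[of E A E f] by (simp add: partial_iso_def)
qed

text \<open>The point is added together with a strong closure of \<open>insert x A\<close>, so that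
  the richness property applies again.\<close>

lemma partial_iso_forth:
  assumes "partial_iso A f" "x \<in> X"
  obtains B g where "partial_iso B g" "A \<subseteq> B" "x \<in> B" "\<And>x. x \<in> A \<Longrightarrow> g x = f x"
proof -
  have A: "finite A" "A \<subseteq> X" "strong E A X" using assms strong_subsetD by (auto simp: partial_iso_def)
  obtain B where B: "finite B" "insert x A \<subseteq> B" "strong E B X"
    using exists_strong_closure[OF sparse, of "insert x A"] A assms(2) by (metis finite_insert insert_subset)
  have BX: "B \<subseteq> X" using B(3) by (rule strong_subsetD)
  have "strong E A B" using B(2) by (intro strong_mono[OF A(3) _ BX]) auto
  moreover have "sparse E B" using sparse BX by (rule sparse_subset)
  ultimately obtain g where "\<forall>x\<in>A. g x = f x" "embeds E B E g" "strong E (g ` B) X"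
    using extension[of B A E f] assms(1) B by (auto simp: partial_iso_def)
  then show ?thesis using B by (intro that[of B g]) (auto simp: partial_iso_def)
qed

text \<open>As relations, partial isomorphisms have converses and increasing unions without any
  bookkeeping of domains.\<close>

definition graph_iso :: "(nat \<times> nat) set \<Rightarrow> bool" where
  "graph_iso p \<longleftrightarrow> (\<exists>A f. partial_iso A f \<and> p = (\<lambda>x. (x, f x)) ` A)"

lemma graph_iso_converse:
  assumes "graph_iso p"
  shows "graph_iso (p\<inverse>)"
proof -
  obtain A f where A: "partial_iso A f" "p = (\<lambda>x. (x, f x)) ` A"
    using assms by (auto simp: graph_iso_def)
  have inj: "inj_on f A" using A(1) embedsD(1) by (auto simp: partial_iso_def)
  have "p\<inverse> = (\<lambda>y. (y, inv_into A f y)) ` f ` A"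
    using inj by (auto simp: A(2) image_iff)
  then show ?thesis using partial_iso_inv[OF A(1)] by (auto simp: graph_iso_def)
qed

lemma graph_iso_forth:
  assumes "graph_iso p" "x \<in> X"
  obtains q where "graph_iso q" "p \<subseteq> q" "x \<in> Domain q"
proof -
  obtain A f where A: "partial_iso A f" "p = (\<lambda>x. (x, f x)) ` A"
    using assms by (auto simp: graph_iso_def)
  obtain B g where B: "partial_iso B g" "A \<subseteq> B" "x \<in> B" "\<And>x. x \<in> A \<Longrightarrow> g x = f x"
    using partial_iso_forth[OF A(1) assms(2)] by blast
  show ?thesis
  proof (rule that)
    show "graph_iso ((\<lambda>x. (x, g x)) ` B)" using B(1) by (auto simp: graph_iso_def)
    show "p \<subseteq> (\<lambda>x. (x, g x)) ` B" using A(2) B(2,4) by force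
    show "x \<in> Domain ((\<lambda>x. (x, g x)) ` B)" using B(3) by (auto simp: Domain_iff)
  qed
qed

text \<open>The back step is a forth step for the converse relation.\<close>

lemma graph_iso_back_and_forth:
  assumes "graph_iso p" "x \<in> X"
  obtains q where "graph_iso q" "p \<subseteq> q" "x \<in> Domain q" "x \<in> Range q"
proof -
  obtain q where q: "graph_iso q" "p \<subseteq> q" "x \<in> Domain q" using graph_iso_forth[OF assms] .
  obtain r where r: "graph_iso r" "q\<inverse> \<subseteq> r" "x \<in> Domain r"
    using graph_iso_forth[OF graph_iso_converse[OF q(1)] assms(2)] .
  have qr: "q \<subseteq> r\<inverse>" using r(2) by auto
  show ?thesis
  proof (rule that)
    show "graph_iso (r\<inverse>)" using r(1) by (rule graph_iso_converse)
    show "p \<subseteq> r\<inverse>" using q(2) qr by (rule subset_trans)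
    show "x \<in> Domain (r\<inverse>)" using q(3) qr by (rule rev_subsetD[OF _ Domain_mono])
    show "x \<in> Range (r\<inverse>)" using r(3) by simp
  qed
qed

text \<open>Homogeneity by back and forth. Edges are preserved in the limit because each finite set
  lies in the domain of a single stage.\<close>

theorem partial_iso_extends:
  assumes "partial_iso A f"
  obtains g where "g \<in> aut" "\<And>x. x \<in> A \<Longrightarrow> g x = f x"
proof -
  let ?p0 = "(\<lambda>x. (x, f x)) ` A"
  have "\<exists>P. (P 0 = ?p0) \<and> (\<forall>n. graph_iso (P n) \<and> P n \<subseteq> P (Suc n) \<and>
      (n \<in> X \<longrightarrow> n \<in> Domain (P (Suc n)) \<and> n \<in> Range (P (Suc n))))"
  proof -
    \<comment> \<open>Points of \<open>X\<close> are natural numbers, so stage \<open>n\<close>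
      treats the point \<open>n\<close> itself. The clause for \<open>n = 0\<close> carries the
      starting value through the dependent choice.\<close>
    have "\<exists>P. \<forall>n. (graph_iso (P n) \<and> (n = 0 \<longrightarrow> P n = ?p0)) \<and> (P n \<subseteq> P (Suc n) \<and>
      (n \<in> X \<longrightarrow> n \<in> Domain (P (Suc n)) \<and> n \<in> Range (P (Suc n))))"
    proof (rule dependent_nat_choice)
      have "graph_iso ?p0" unfolding graph_iso_def using assms by (intro exI conjI) auto
      then show "\<exists>p. graph_iso p \<and> ((0::nat) = 0 \<longrightarrow> p = ?p0)" by simp
      fix p and n :: nat assume p: "graph_iso p \<and> (n = 0 \<longrightarrow> p = ?p0)"
      show "\<exists>q. (graph_iso q \<and> (Suc n = 0 \<longrightarrow> q = ?p0)) \<and> (p \<subseteq> q \<and>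
          (n \<in> X \<longrightarrow> n \<in> Domain q \<and> n \<in> Range q))"
      proof (cases "n \<in> X")
        case True
        obtain q where "graph_iso q" "p \<subseteq> q" "n \<in> Domain q" "n \<in> Range q"
          using graph_iso_back_and_forth[OF conjunct1[OF p] True] .
        then show ?thesis by (intro exI[of _ q]) auto
      next
        case False
        then show ?thesis using p by (intro exI[of _ p]) auto
      qed
    qed
    then obtain P where "\<forall>n. (graph_iso (P n) \<and> (n = 0 \<longrightarrow> P n = ?p0)) \<and> (P n \<subseteq> P (Suc n) \<and>
      (n \<in> X \<longrightarrow> n \<in> Domain (P (Suc n)) \<and> n \<in> Range (P (Suc n))))" ..
    then show ?thesis by (intro exI[of _ P]) simp
  qed
  then obtain P where P0: "P 0 = ?p0" and P: "\<forall>n. graph_iso (P n) \<and> P n \<subseteq> P (Suc n) \<and>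
      (n \<in> X \<longrightarrow> n \<in> Domain (P (Suc n)) \<and> n \<in> Range (P (Suc n)))"
    by (elim exE conjE)
  have iso: "graph_iso (P n)" and step: "P n \<subseteq> P (Suc n)" for n using P by simp_all
  have dom: "n \<in> Domain (P (Suc n))" and ran: "n \<in> Range (P (Suc n))" if "n \<in> X" for n
    using P that by simp_all
  have mono: "P m \<subseteq> P n" if "m \<le> n" for m n
    using lift_Suc_mono_le[of P, OF step that] .
  define R where "R = (\<Union>n. P n)"
  have common: "\<exists>n. Q \<subseteq> P n" if "finite Q" "Q \<subseteq> R" for Q
    using that
  proof (induction Q)
    case (insert a Q)
    then obtain n m where "Q \<subseteq> P n" "a \<in> P m" by (auto simp: R_def)
    then have "insert a Q \<subseteq> P (max n m)" using mono[of n "max n m"] mono[of m "max n m"] by auto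
    then show ?case by blast
  qed simp
  have R_X: "x \<in> X \<and> y \<in> X" if "(x, y) \<in> R" for x y
  proof -
    obtain n where n: "(x, y) \<in> P n" using \<open>(x, y) \<in> R\<close> by (auto simp: R_def)
    obtain B g where "partial_iso B g" "P n = (\<lambda>x. (x, g x)) ` B"
      using iso[of n] by (auto simp: graph_iso_def)
    then show ?thesis using n strong_subsetD[of E B X] strong_subsetD[of E "g ` B" X]
      by (auto simp: partial_iso_def)
  qed
  have R_unique: "x = x' \<longleftrightarrow> y = y'" if xy: "(x, y) \<in> R" "(x', y') \<in> R" for x y x' y'
  proof -
    obtain n where n: "{(x, y), (x', y')} \<subseteq> P n" using common[of "{(x, y), (x', y')}"] xy by auto
    obtain B g where B: "partial_iso B g" "P n = (\<lambda>x. (x, g x)) ` B"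
      using iso[of n] by (auto simp: graph_iso_def)
    have "inj_on g B" using B(1) embedsD(1) by (auto simp: partial_iso_def)
    then show ?thesis using n B(2) by (auto simp: inj_on_eq_iff)
  qed
  have R_dom: "\<exists>y. (x, y) \<in> R" if "x \<in> X" for x using dom[OF that] by (auto simp: R_def)
  have R_ran: "\<exists>x. (x, y) \<in> R" if "y \<in> X" for y using ran[OF that] by (auto simp: R_def)
  define g where "g = (\<lambda>x\<in>X. THE y. (x, y) \<in> R)"
  have g: "g x = y" if "(x, y) \<in> R" for x y
  proof -
    have "(THE y. (x, y) \<in> R) = y" by (rule the_equality) (use R_unique that in blast)+
    then show ?thesis using R_X[OF that] by (simp add: g_def)
  qed
  have gR: "(x, g x) \<in> R" if "x \<in> X" for x using R_dom[OF that] g by blast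
  have "bij_betw g X X"
  proof (rule bij_betw_imageI)
    show "inj_on g X"
    proof (rule inj_onI)
      fix x x' assume "x \<in> X" "x' \<in> X" "g x = g x'"
      then show "x = x'" using R_unique[OF gR gR, of x x'] by simp
    qed
    show "g ` X = X" using R_ran g gR R_X by (auto simp: image_iff) (metis)+
  qed
  then have bij: "g \<in> Bij X" by (simp add: Bij_def g_def)
  have "g ` e \<in> E \<longleftrightarrow> e \<in> E" if e: "finite e" "e \<subseteq> X" for e
  proof -
    have "finite ((\<lambda>x. (x, g x)) ` e)" "(\<lambda>x. (x, g x)) ` e \<subseteq> R" using e gR by auto
    then obtain n where n: "(\<lambda>x. (x, g x)) ` e \<subseteq> P n" using common by blast
    obtain B h where B: "partial_iso B h" "P n = (\<lambda>x. (x, h x)) ` B"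
      using iso[of n] by (auto simp: graph_iso_def)
    have eB: "e \<subseteq> B" "\<And>x. x \<in> e \<Longrightarrow> g x = h x" using n B(2) by auto
    then have "g ` e = h ` e" by auto
    moreover have "embeds E B E h" using B(1) by (simp add: partial_iso_def)
    ultimately show ?thesis using embedsD(2)[of E B E h e] eB(1) by simp
  qed
  then have "g \<in> aut" using bij by (simp add: aut_def)
  moreover have "g x = f x" if "x \<in> A" for x
  proof (rule g)
    have "(x, f x) \<in> P 0" using that P0 by auto
    then show "(x, f x) \<in> R" by (auto simp: R_def)
  qed
  ultimately show ?thesis by (rule that)
qed

section \<open>The automorphisms as a closed, oligomorphic group\<close>

lemma aut_Bij: "g \<in> aut \<Longrightarrow> g \<in> Bij X"
  by (simp add: aut_def)

lemma aut_mem: "g \<in> aut \<Longrightarrow> x \<in> X \<Longrightarrow> g x \<in> X"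
  using BijD(1)[OF aut_Bij] bij_betwE by blast

lemma aut_edge: "g \<in> aut \<Longrightarrow> finite e \<Longrightarrow> e \<subseteq> X \<Longrightarrow> g ` e \<in> E \<longleftrightarrow> e \<in> E"
  by (simp add: aut_def)

lemma subgroup_aut: "subgroup aut (BijGroup X)"
proof (rule group.subgroupI[OF group_BijGroup])
  show "aut \<subseteq> carrier (BijGroup X)" using aut_Bij by (auto simp: BijGroup_def)
  have "(\<lambda>x\<in>X. x) \<in> aut"
  proof -
    have "(\<lambda>x\<in>X. x) ` e = e" if "e \<subseteq> X" for e using that by (auto simp: image_def)
    then show ?thesis by (simp add: aut_def id_Bij)
  qed
  then show "aut \<noteq> {}" by blast
next
  fix g assume g: "g \<in> aut"
  note b = BijD(1)[OF aut_Bij[OF g]]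
  have "(\<lambda>x\<in>X. inv_into X g x) \<in> aut"
    unfolding aut_def
  proof (intro CollectI conjI allI impI restrict_inv_into_Bij aut_Bij[OF g])
    fix e assume e: "finite e" "e \<subseteq> X"
    let ?e = "(\<lambda>x\<in>X. inv_into X g x) ` e"
    have "?e = inv_into X g ` e" using e by (auto simp: image_def)
    moreover have "inv_into X g ` e \<subseteq> X" using e b inv_into_into[of _ g X] by (auto simp: bij_betw_def)
    moreover have "g ` inv_into X g ` e = e"
      using e b by (intro image_inv_into_cancel) (auto simp: bij_betw_def)
    ultimately show "?e \<in> E \<longleftrightarrow> e \<in> E" using aut_edge[OF g, of ?e] e by simp
  qed
  then show "inv\<^bsub>BijGroup X\<^esub> g \<in> aut" using inv_BijGroup[OF aut_Bij[OF g]] by simp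
next
  fix g h assume g: "g \<in> aut" and h: "h \<in> aut"
  have "compose X g h \<in> aut"
    unfolding aut_def
  proof (intro CollectI conjI allI impI compose_Bij aut_Bij g h)
    fix e assume e: "finite e" "e \<subseteq> X"
    have "compose X g h ` e = g ` h ` e" using e by (auto simp: compose_def image_def)
    moreover have "h ` e \<subseteq> X" using aut_mem[OF h] e by auto
    ultimately show "compose X g h ` e \<in> E \<longleftrightarrow> e \<in> E"
      using aut_edge[OF g, of "h ` e"] aut_edge[OF h e] e by simp
  qed
  then show "g \<otimes>\<^bsub>BijGroup X\<^esub> h \<in> aut" using aut_Bij g h by (simp add: BijGroup_def)
qed

lemma closed_aut: "closedin (sym_topology X) aut"
proof -
  define U where
    "U = {f \<in> X \<rightarrow>\<^sub>E X. \<exists>e. finite e \<and> e \<subseteq> X \<and> (f ` e \<in> E) \<noteq> (e \<in> E)}"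
  have "openin (product_topology (\<lambda>_. discrete_topology X) X) U"
    unfolding openin_product_discrete_iff
  proof (intro conjI ballI)
    fix f assume "f \<in> U"
    then obtain e where e: "finite e" "e \<subseteq> X" "(f ` e \<in> E) \<noteq> (e \<in> E)" by (auto simp: U_def)
    have "g \<in> U" if "g \<in> X \<rightarrow>\<^sub>E X" "\<forall>j\<in>e. g j = f j" for g
    proof -
      have "g ` e = f ` e" using that(2) by auto
      then show ?thesis using e that(1) by (auto simp: U_def)
    qed
    then show "\<exists>J. finite J \<and> J \<subseteq> X \<and> (\<forall>g\<in>X \<rightarrow>\<^sub>E X. (\<forall>j\<in>J. g j = f j) \<longrightarrow> g \<in> U)"
      using e by blast
  qed (auto simp: U_def)
  then have "openin (sym_topology X) (U \<inter> Bij X)"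
    by (auto simp: sym_topology_def openin_subtopology)
  moreover have "Bij X - aut = U \<inter> Bij X"
    by (auto simp: aut_def U_def PiE_def dest: Bij_imp_funcset Bij_imp_extensional)
  ultimately show ?thesis
    using aut_Bij by (auto simp: closedin_def topspace_sym_topology)
qed

lemma closed_permutation_group_aut: "closed_permutation_group aut X"
  using subgroup_aut closed_aut by (simp add: closed_permutation_group_def)

text \<open>A tuple is coded by its strong closure, moved to an initial segment
  \<open>{..<k}\<close>, with the position of the tuple in it. Since
  \<open>k < 2 ^ length xs\<close>, tuples of a given length have only finitely many codes.\<close>

lemma list_code_exists:
  assumes "set xs \<subseteq> X"
  obtains k :: nat and D ys f where "k < 2 ^ length xs" "D \<subseteq> Pow {..<k}" "set ys \<subseteq> {..<k}" "map f ys = xs"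
    "embeds D {..<k} E f" "strong E (f ` {..<k}) X"
proof -
  obtain F where F: "finite F" "set xs \<subseteq> F" "strong E F X" "card F < 2 ^ card (set xs)"
    using exists_strong_closure[OF sparse, of "set xs"] assms by auto
  obtain f where f: "bij_betw f {..<card F} F"
    using ex_bij_betw_nat_finite[OF F(1)] by (auto simp: atLeast0LessThan)
  define D where "D = {d. d \<subseteq> {..<card F} \<and> f ` d \<in> E}"
  define ys where "ys = map (inv_into {..<card F} f) xs"
  have fim: "f ` {..<card F} = F" using f by (simp add: bij_betw_def)
  show ?thesis
  proof (rule that)
    have "(2::nat) ^ card (set xs) \<le> 2 ^ length xs"
      by (intro power_increasing card_length) simp
    then show "card F < 2 ^ length xs" using F(4) by linarith
    show "D \<subseteq> Pow {..<card F}" by (auto simp: D_def)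
    show "set ys \<subseteq> {..<card F}"
      using F(2) inv_into_into[of _ f "{..<card F}"] by (auto simp: ys_def fim)
    have "f (inv_into {..<card F} f x) = x" if "x \<in> set xs" for x
      using f_inv_into_f[of x f "{..<card F}"] that F(2) fim by blast
    then show "map f ys = xs" by (auto simp: ys_def intro: map_idI)
    show "embeds D {..<card F} E f" using f by (auto simp: embeds_def D_def bij_betw_def)
    show "strong E (f ` {..<card F}) X" using F(3) by (simp add: fim)
  qed
qed

text \<open>The map from one realisation of the code to the other is an isomorphism between finite
  strong sets; homogeneity extends it to an automorphism that carries \<open>xs\<close> to
  \<open>xs'\<close>.\<close>

lemma same_code_orbit:
  fixes k :: nat
  assumes "D \<subseteq> Pow {..<k}" "set ys \<subseteq> {..<k}"
    and f: "map f ys = xs" "embeds D {..<k} E f" "strong E (f ` {..<k}) X"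
    and f': "map f' ys = xs'" "embeds D {..<k} E f'" "strong E (f' ` {..<k}) X"
  shows "orbit (permgroup aut X) map xs' \<subseteq> orbit (permgroup aut X) map xs"
proof -
  let ?K = "{..<k}"
  have inv: "inv_into ?K f (f x) = x" if "x \<in> ?K" for x
    using inv_into_f_f[OF embedsD(1)[OF f(2)] that] .
  have im: "(f' \<circ> inv_into ?K f) ` f ` ?K = f' ` ?K" using inv by (auto simp: image_comp)
  have "partial_iso (f ` ?K) (f' \<circ> inv_into ?K f)"
    unfolding partial_iso_def im
  proof (intro conjI f(3) f'(3))
    show "embeds E (f ` ?K) E (f' \<circ> inv_into ?K f)"
      by (rule embeds_comp[OF embeds_inv[OF f(2)] f'(2)]) (use inv in auto)
  qed (intro finite_imageI finite_lessThan)
  then obtain g where g: "g \<in> aut" "\<And>x. x \<in> f ` ?K \<Longrightarrow> g x = (f' \<circ> inv_into ?K f) x"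
    using partial_iso_extends by blast
  have "g (f y) = f' y" if "y \<in> set ys" for y
    using g(2)[of "f y"] inv[of y] that assms(2) by auto
  then have gx: "map g xs = xs'" using f(1) f'(1) by auto
  have xsX: "set xs \<subseteq> X"
  proof
    fix x assume "x \<in> set xs"
    then obtain y where "y \<in> set ys" "x = f y" using f(1) by auto
    then show "x \<in> X" using assms(2) strong_subsetD[OF f(3)] by (meson image_subset_iff subsetD)
  qed
  show ?thesis
  proof
    fix zs assume "zs \<in> orbit (permgroup aut X) map xs'"
    then obtain h where h: "h \<in> aut" "zs = map h xs'" by (auto simp: orbit_def)
    have "compose X h g \<in> aut"
      using subgroup.m_closed[OF subgroup_aut h(1) g(1)] aut_Bij h(1) g(1) by (simp add: BijGroup_def)
    moreover have "zs = map (compose X h g) xs"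
      using h(2) xsX by (auto simp: gx[symmetric] compose_def)
    ultimately show "zs \<in> orbit (permgroup aut X) map xs" by (auto simp: orbit_def)
  qed
qed

theorem oligomorphic_aut: "oligomorphic aut X"
  unfolding oligomorphic_def
proof
  fix n
  define C where "C = (SIGMA k:{..<(2::nat) ^ n}. Pow (Pow {..<k}) \<times> {ys. set ys \<subseteq> {..<k} \<and> length ys = n})"
  have "finite C"
    unfolding C_def
  proof (rule finite_SigmaI)
    fix k :: nat
    have "finite {ys. set ys \<subseteq> {..<k} \<and> length ys = n}"
      using finite_lists_length_eq[of "{..<k}" n] by simp
    then show "finite (Pow (Pow {..<k}) \<times> {ys. set ys \<subseteq> {..<k} \<and> length ys = n})" by simp
  qed simp
  define codes where "codes = (\<lambda>xs (k :: nat, D, ys). \<exists>f. D \<subseteq> Pow {..<k} \<and> set ys \<subseteq> {..<k} \<and>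
     map f ys = xs \<and> embeds D {..<k} E f \<and> strong E (f ` {..<k}) X)"
  let ?orb = "orbit (permgroup aut X) map"
  have eq: "?orb xs = ?orb xs'" if "codes xs c" "codes xs' c" for xs xs' c
  proof -
    obtain k D ys where c: "c = (k, D, ys)" by (cases c)
    from that obtain f f' where "D \<subseteq> Pow {..<k}" "set ys \<subseteq> {..<k}"
      "map f ys = xs" "embeds D {..<k} E f" "strong E (f ` {..<k}) X"
      "map f' ys = xs'" "embeds D {..<k} E f'" "strong E (f' ` {..<k}) X"
      by (auto simp: codes_def c)
    then show ?thesis using same_code_orbit[of D k ys] by (metis subset_antisym)
  qed
  have "orbits (permgroup aut X) {xs. length xs = n \<and> set xs \<subseteq> X} map
      \<subseteq> (\<lambda>c. ?orb (SOME xs. codes xs c)) ` C"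
  proof
    fix O' assume "O' \<in> orbits (permgroup aut X) {xs. length xs = n \<and> set xs \<subseteq> X} map"
    then obtain xs where xs: "length xs = n" "set xs \<subseteq> X" "O' = ?orb xs"
      by (auto simp: orbits_def)
    obtain k :: nat and D ys f where c: "k < 2 ^ length xs" "D \<subseteq> Pow {..<k}" "set ys \<subseteq> {..<k}"
      "map f ys = xs" "embeds D {..<k} E f" "strong E (f ` {..<k}) X"
      using list_code_exists[OF xs(2)] .
    have code: "codes xs (k, D, ys)" using c by (auto simp: codes_def)
    have "length ys = n" using c(4) xs(1) by auto
    then have "(k, D, ys) \<in> C" using c xs(1) by (auto simp: C_def)
    moreover have "O' = ?orb (SOME xs. codes xs (k, D, ys))"
      unfolding xs(3) by (rule eq[OF code]) (rule someI[of "\<lambda>xs. codes xs (k, D, ys)", OF code])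
    ultimately show "O' \<in> (\<lambda>c. ?orb (SOME xs. codes xs c)) ` C" by blast
  qed
  then show "finite (orbits (permgroup aut X) {xs. length xs = n \<and> set xs \<subseteq> X} map)"
    using \<open>finite C\<close> finite_surj by blast
qed

end

section \<open>Linked copies of a finite set\<close>

text \<open>Disjoint unlinked pieces add their sizes and their predimensions, and this keeps them
  sparse. With the powers written as \<open>Suc p\<close> and \<open>Suc q\<close>, the step is
  \<open>p + q < Suc p * Suc q\<close>.\<close>

lemma sum_less_power2_sum:
  fixes a d :: "nat \<Rightarrow> nat"
  assumes "\<And>j. j < m \<Longrightarrow> a j < 2 ^ d j"
  shows "(\<Sum>j<m. a j) < 2 ^ (\<Sum>j<m. d j)"
  using assms
proof (induction m)
  case (Suc m)
  let ?A = "\<Sum>j<m. a j" and ?D = "\<Sum>j<m. d j"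
  have "?A < 2 ^ ?D" "a m < 2 ^ d m" using Suc by auto
  then obtain p q where pq: "(2::nat) ^ ?D = Suc p" "?A \<le> p" "(2::nat) ^ d m = Suc q" "a m \<le> q"
    by (metis Suc_leI Suc_le_mono less_imp_Suc_add le_add1)
  have "?A + a m < Suc p * Suc q" using pq by simp
  then show ?case by (simp add: power_add pq)
qed simp

text \<open>At 8 both sides equal 64, so 9 is the right start.\<close>

lemma square_less_power2: "n * n < 2 ^ (n - 2)" if "9 \<le> n" for n :: nat
  using that
proof (induction n rule: dec_induct)
  case (step n)
  have "Suc n * Suc n \<le> 2 * (n * n)"
  proof -
    have "3 * n \<le> n * n" using step.hyps by (intro mult_right_mono) auto
    moreover have "Suc n * Suc n = n * n + 2 * n + 1" by simp
    ultimately show ?thesis using step.hyps by linarith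
  qed
  also have "\<dots> < 2 * 2 ^ (n - 2)" using step.IH by simp
  also have "\<dots> = 2 ^ (Suc n - 2)"
    using step.hyps by (simp add: power_Suc[symmetric] Suc_diff_le del: power_Suc)
  finally show ?case .
qed simp

text \<open>The size of \<open>m\<close> is used three times:
  \<open>card C \<le> m * m < 2 ^ (m - 2)\<close> for sparseness, \<open>delta E F < m - 1\<close>
  for strongness of the copies, and at least three copies, so that no link fits into one of
  them.\<close>

locale linked_copies =
  fixes E :: "nat set set" and F :: "nat set" and m :: nat
  assumes finite_F: "finite F" and F_nonempty: "F \<noteq> {}" and sparse_F: "sparse E F"
    and m_large: "card F + 10 \<le> m"
begin

definition copy :: "nat \<Rightarrow> nat \<Rightarrow> nat" where "copy j x = prod_encode (j, x)"

definition C :: "nat set" where "C = (\<Union>j<m. copy j ` F)"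

definition part :: "nat set \<Rightarrow> nat \<Rightarrow> nat set" where "part Y j = {x \<in> F. copy j x \<in> Y}"

definition copied :: "nat set set" where
  "copied = (\<Union>j<m. (`) (copy j) ` edges_in E F)"

text \<open>With this number of links, \<open>\<delta>(C) = m - 1\<close> is just below the number of copies.\<close>

definition links :: "nat set set" where
  "links = (\<lambda>v. C - {v}) ` (SOME W. W \<subseteq> C \<and> card W = m * (nat (delta E F) - 1) + 1)"

lemma copy_eq_iff [simp]: "copy i x = copy j y \<longleftrightarrow> i = j \<and> x = y"
  by (simp add: copy_def)

lemma inj_copy: "inj_on (copy j) A"
  by (simp add: inj_on_def)

lemma finite_C: "finite C"
  using finite_F by (simp add: C_def)

lemma delta_F: "1 \<le> delta E F"
  using sparse_delta_pos[OF sparse_F] finite_F F_nonempty by simp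

lemma no_empty_edge: "{} \<notin> E"
  using sparse_F by (rule sparse_no_empty_edge)

lemma part_subset: "part Y j \<subseteq> F"
  by (auto simp: part_def)

lemma finite_part: "finite (part Y j)"
  using part_subset finite_F by (rule finite_subset)

lemma decompose:
  assumes "Y \<subseteq> C"
  shows "Y = (\<Union>j<m. copy j ` part Y j)"
proof
  show "Y \<subseteq> (\<Union>j<m. copy j ` part Y j)"
  proof
    fix y assume y: "y \<in> Y"
    then obtain j x where "j < m" "x \<in> F" "y = copy j x" using assms by (auto simp: C_def)
    then show "y \<in> (\<Union>j<m. copy j ` part Y j)" using y by (auto simp: part_def)
  qed
qed (auto simp: part_def)

lemma card_decompose:
  assumes "Y \<subseteq> C"
  shows "card Y = (\<Sum>j<m. card (part Y j))"
proof -
  have "card (\<Union>j<m. copy j ` part Y j) = (\<Sum>j<m. card (copy j ` part Y j))"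
    by (rule card_UN_disjoint) (auto simp: finite_part)
  then show ?thesis using decompose[OF assms] by (simp add: card_image inj_copy)
qed

lemma card_C: "card C = m * card F"
proof -
  have "part C j = F" if "j < m" for j using that by (auto simp: part_def C_def)
  then show ?thesis using card_decompose[of C] by simp
qed

lemma edges_in_copied: "edges_in copied Y = (\<Union>j<m. (`) (copy j) ` edges_in E (part Y j))"
  by (auto simp: edges_in_def copied_def part_def)

lemma delta_copied:
  assumes "Y \<subseteq> C"
  shows "delta copied Y = (\<Sum>j<m. delta E (part Y j))"
proof -
  have "card (edges_in copied Y) = (\<Sum>j<m. card ((`) (copy j) ` edges_in E (part Y j)))"
    unfolding edges_in_copied
  proof (rule card_UN_disjoint)
    show "\<forall>i\<in>{..<m}. \<forall>j\<in>{..<m}. i \<noteq> j \<longrightarrow>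
       (`) (copy i) ` edges_in E (part Y i) \<inter> (`) (copy j) ` edges_in E (part Y j) = {}"
    proof (intro ballI impI equals0I)
      fix i j e assume ij: "i \<noteq> j"
        "e \<in> (`) (copy i) ` edges_in E (part Y i) \<inter> (`) (copy j) ` edges_in E (part Y j)"
      then obtain e1 e2 where e: "e1 \<in> E" "e = copy i ` e1" "e = copy j ` e2"
        by (auto simp: edges_in_def)
      then obtain x where "x \<in> e1" using no_empty_edge by (metis ex_in_conv)
      then have "copy i x \<in> copy j ` e2" using e by auto
      then show False using ij(1) by auto
    qed
  qed (auto simp: finite_edges_in finite_part)
  also have "\<dots> = (\<Sum>j<m. card (edges_in E (part Y j)))"
    by (intro sum.cong refl card_image inj_onI) (simp add: inj_image_eq_iff inj_copy)
  finally show ?thesis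
    unfolding delta_def using card_decompose[OF assms] by (simp add: sum_subtractf)
qed

text \<open>There are enough points to delete because \<delta> of \<open>F\<close> is at most
  \<open>card F\<close> and \<open>C\<close> has \<open>m * card F\<close> points.\<close>

lemma links_exist: "\<exists>W\<subseteq>C. card W = m * (nat (delta E F) - 1) + 1"
proof -
  have "nat (delta E F) \<le> card F" using delta_le_card[of E F] by simp
  then have "m * (nat (delta E F) - 1) + 1 \<le> m * (card F - 1) + 1"
    by (intro add_right_mono mult_left_mono diff_le_mono) auto
  also have "\<dots> \<le> m * (card F - 1) + m" using m_large by simp
  also have "\<dots> = m * card F" 
    using finite_F F_nonempty by (cases "card F") auto
  finally show ?thesis using obtain_subset_with_card_n card_C by metis
qed

lemma links_subset: "e \<in> links \<Longrightarrow> \<exists>v\<in>C. e = C - {v}"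
  and card_links: "int (card links) = int m * (delta E F - 1) + 1"
proof -
  define W where "W = (SOME W. W \<subseteq> C \<and> card W = m * (nat (delta E F) - 1) + 1)"
  have W: "W \<subseteq> C" "card W = m * (nat (delta E F) - 1) + 1"
    using someI_ex[OF links_exist] unfolding W_def by auto
  have l: "links = (\<lambda>v. C - {v}) ` W" by (simp add: links_def W_def)
  then show "e \<in> links \<Longrightarrow> \<exists>v\<in>C. e = C - {v}" using W(1) by auto
  have "inj_on (\<lambda>v. C - {v}) W" using W(1) by (auto simp: inj_on_def)
  then have "card links = card W" by (simp add: l card_image)
  then show "int (card links) = int m * (delta E F - 1) + 1"
    using W(2) delta_F by (simp add: of_nat_diff)
qed

definition edges :: "nat set set" where "edges = copied \<union> links"

lemma link_not_in_copy:
  assumes "e \<in> links"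
  shows "\<not> e \<subseteq> copy j ` F"
proof
  assume s: "e \<subseteq> copy j ` F"
  obtain v where v: "v \<in> C" "e = C - {v}" using links_subset[OF assms] by blast
  obtain x where x: "x \<in> F" using F_nonempty by blast
  \<comment> \<open>Of the points \<open>copy 0 x\<close>, \<open>copy 1 x\<close>,
    \<open>copy 2 x\<close>, at most one lies in copy \<open>j\<close> and at most one is the
    deleted point.\<close>
  have "\<exists>i<3. i \<noteq> j \<and> copy i x \<noteq> v"
  proof (rule ccontr)
    assume n: "\<not> ?thesis"
    have c: "i = j \<or> copy i x = v" if "i < 3" for i using n that by blast
    have "(0::nat) < 3" "(1::nat) < 3" "(2::nat) < 3" by auto
    from this[THEN c] have "j = 0 \<and> copy 1 x = copy 2 x \<or> copy 0 x = copy 1 x \<or> copy 0 x = copy 2 x \<or> copy 1 x = copy 2 x"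
      by metis
    then show False by simp
  qed
  then obtain i where i: "i < 3" "i \<noteq> j" "copy i x \<noteq> v" by blast
  then have "copy i x \<in> e" using v x m_large by (auto simp: C_def)
  then show False using s i(2) by auto
qed

lemma copied_in_copy: "e \<in> copied \<Longrightarrow> \<exists>j<m. e \<subseteq> copy j ` F"
  by (auto simp: copied_def edges_in_def)

lemma copied_links_disjoint: "copied \<inter> links = {}"
  using copied_in_copy link_not_in_copy by blast

lemma delta_edges_no_link:
  assumes "\<And>e. e \<in> links \<Longrightarrow> \<not> e \<subseteq> Y"
  shows "delta edges Y = delta copied Y"
  by (rule delta_cong) (use assms in \<open>auto simp: edges_def\<close>)

lemma delta_edges_C: "delta edges C = int m - 1"
proof -
  have "edges_in edges C = edges_in copied C \<union> links"
    using links_subset by (auto simp: edges_in_def edges_def)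
  moreover have "edges_in copied C \<inter> links = {}"
    using copied_links_disjoint by (auto simp: edges_in_def)
  moreover have "finite links"
    by (rule finite_subset[of _ "Pow C"]) (use links_subset finite_C in auto)
  ultimately have "card (edges_in edges C) = card (edges_in copied C) + card links"
    using finite_C by (simp add: card_Un_disjoint finite_edges_in)
  then have "delta edges C = delta copied C - int (card links)" by (simp add: delta_def)
  also have "delta copied C = int m * delta E F"
  proof -
    have "part C j = F" if "j < m" for j using that by (auto simp: part_def C_def)
    then show ?thesis using delta_copied[of C] by simp
  qed
  finally show ?thesis by (simp add: card_links algebra_simps)
qed

text \<open>Deleting \<open>v\<close> leaves \<open>m - 1\<close> copies intact and a remainder of
  nonnegative predimension. Only one link fits into \<open>C - {v}\<close>, namely that set itself,
  and it costs 1.\<close>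

lemma delta_edges_link:
  assumes v: "v \<in> C"
  shows "int (m - 1) * delta E F - 1 \<le> delta edges (C - {v})"
proof -
  let ?Y = "C - {v}"
  obtain i x where ix: "i < m" "v = copy i x" using v by (auto simp: C_def)
  have "edges_in edges ?Y \<subseteq> insert ?Y (edges_in copied ?Y)"
  proof
    fix e assume e: "e \<in> edges_in edges ?Y"
    show "e \<in> insert ?Y (edges_in copied ?Y)"
    proof (cases "e \<in> links")
      case True
      then obtain w where w: "w \<in> C" "e = C - {w}" using links_subset by blast
      then have "e = ?Y" using e v by (auto simp: edges_in_def)
      then show ?thesis by simp
    next
      case False
      then show ?thesis using e by (auto simp: edges_in_def edges_def)
    qed
  qed
  moreover have "finite (insert ?Y (edges_in copied ?Y))" using finite_C by (simp add: finite_edges_in)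
  ultimately have "card (edges_in edges ?Y) \<le> card (insert ?Y (edges_in copied ?Y))"
    by (rule card_mono[rotated])
  also have "\<dots> \<le> Suc (card (edges_in copied ?Y))" by (rule card_insert_le_m1) auto
  finally have "delta copied ?Y - 1 \<le> delta edges ?Y" unfolding delta_def by linarith
  moreover have "int (m - 1) * delta E F \<le> delta copied ?Y"
  proof -
    have p: "part ?Y j = F" if "j < m" "j \<noteq> i" for j using that ix by (auto simp: part_def C_def)
    have "delta copied ?Y = (\<Sum>j<m. delta E (part ?Y j))" by (rule delta_copied) auto
    also have "\<dots> = delta E (part ?Y i) + (\<Sum>j\<in>{..<m} - {i}. delta E (part ?Y j))"
      using ix(1) by (simp add: sum.remove)
    also have "(\<Sum>j\<in>{..<m} - {i}. delta E (part ?Y j)) = (\<Sum>j\<in>{..<m} - {i}. delta E F)"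
      by (intro sum.cong refl) (use p in auto)
    also have "\<dots> = int (m - 1) * delta E F" using ix(1) by simp
    finally show ?thesis using sparseD(1)[OF sparse_F part_subset finite_part] by simp
  qed
  ultimately show ?thesis by linarith
qed

text \<open>A link is \<open>C\<close> minus one point, so a proper subset of \<open>C\<close>
  containing a link equals it. Thus the many links lower the predimension together only at
  \<open>C\<close> itself.\<close>

lemma link_cases:
  assumes "Y \<subseteq> C"
  obtains "Y = C" | v where "v \<in> C" "Y = C - {v}" | "\<And>e. e \<in> links \<Longrightarrow> \<not> e \<subseteq> Y"
  using assms links_subset by blast

text \<open>The exponent \<open>m - 2\<close> is the lower bound for the predimension of
  \<open>C\<close> minus a point: \<open>(m - 1) * delta E F - 1\<close> with \<delta> of
  \<open>F\<close> at least 1.\<close>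

lemma C_small: "card C < 2 ^ (m - 2)"
proof -
  have "card C \<le> m * m" using card_C m_large by simp
  also have "\<dots> < 2 ^ (m - 2)" using m_large by (intro square_less_power2) auto
  finally show ?thesis .
qed

lemma sparse_edges: "sparse edges C"
  unfolding sparse_def
proof (intro allI impI)
  fix Y assume Y: "Y \<subseteq> C" "finite Y"
  show "0 \<le> delta edges Y \<and> card Y < 2 ^ nat (delta edges Y)"
    using Y(1)
  proof (cases rule: link_cases)
    case 1
    have "card C < 2 ^ (m - 1)"
      using C_small by (rule order_less_le_trans) (intro power_increasing, auto)
    moreover have "nat (int m - 1) = m - 1" by simp
    ultimately show ?thesis using 1 delta_edges_C m_large by simp
  next
    case (2 v)
    have "int (m - 1) * 1 \<le> int (m - 1) * delta E F" using delta_F by (intro mult_left_mono) auto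
    then have d: "int m - 2 \<le> delta edges Y" using delta_edges_link[OF 2(1)] m_large
      unfolding 2(2) by linarith
    then have "m - 2 \<le> nat (delta edges Y)" by linarith
    then have "(2::nat) ^ (m - 2) \<le> 2 ^ nat (delta edges Y)" by (intro power_increasing) auto
    moreover have "card Y \<le> card C" using Y(1) finite_C by (rule card_mono[rotated])
    ultimately have "card Y < 2 ^ nat (delta edges Y)" using C_small by linarith
    then show ?thesis using d m_large by simp
  next
    case 3
    note s = sparseD[OF sparse_F part_subset finite_part]
    have "delta edges Y = (\<Sum>j<m. delta E (part Y j))"
      using delta_edges_no_link[OF 3] delta_copied[OF Y(1)] by simp
    also have "\<dots> = int (\<Sum>j<m. nat (delta E (part Y j)))" using s(1) by simp
    finally have d: "delta edges Y = int (\<Sum>j<m. nat (delta E (part Y j)))" .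
    have "card Y < 2 ^ (\<Sum>j<m. nat (delta E (part Y j)))"
      unfolding card_decompose[OF Y(1)] by (rule sum_less_power2_sum) (rule s(2))
    then show ?thesis unfolding d by (simp del: of_nat_sum)
  qed
qed

lemma delta_copy: "i < m \<Longrightarrow> delta edges (copy i ` F) = delta E F"
proof -
  assume i: "i < m"
  then have sub: "copy i ` F \<subseteq> C" by (auto simp: C_def)
  have "delta edges (copy i ` F) = delta copied (copy i ` F)"
    by (rule delta_edges_no_link) (rule link_not_in_copy)
  also have "\<dots> = (\<Sum>j<m. delta E (part (copy i ` F) j))" using sub by (rule delta_copied)
  also have "\<dots> = (\<Sum>j<m. if j = i then delta E F else 0)"
  proof (intro sum.cong refl)
    fix j
    have "part (copy i ` F) j = (if j = i then F else {})" by (auto simp: part_def)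
    then show "delta E (part (copy i ` F) j) = (if j = i then delta E F else 0)"
      using delta_empty[OF no_empty_edge] by simp
  qed
  also have "\<dots> = delta E F" using i by simp
  finally show ?thesis .
qed

text \<open>All of \<open>C\<close> has predimension \<open>m - 1\<close>, beyond that of
  \<open>F\<close> by the choice of \<open>m\<close>; \<open>C\<close> minus a point has at least
  \<open>3 * delta E F - 1\<close>; a set without links gains at least 1 from its points in another
  copy.\<close>

lemma strong_copy:
  assumes i: "i < m"
  shows "strong edges (copy i ` F) C"
  unfolding strong_def
proof (intro conjI allI impI)
  show "copy i ` F \<subseteq> C" using i by (auto simp: C_def)
  fix Y assume Y: "finite Y \<and> copy i ` F \<subset> Y \<and> Y \<subseteq> C"
  have dm: "delta E F + 10 \<le> int m" using delta_le_card[of E F] m_large by linarith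
  from Y have "Y \<subseteq> C" by blast
  then have "delta E F < delta edges Y"
  proof (cases rule: link_cases)
    case 1
    then show ?thesis using delta_edges_C dm by simp
  next
    case (2 v)
    have "3 * delta E F \<le> int (m - 1) * delta E F"
      using delta_F m_large by (intro mult_right_mono) auto
    then show ?thesis using delta_edges_link[OF 2(1)] delta_F unfolding 2(2) by linarith
  next
    case 3
    obtain y where y: "y \<in> Y" "y \<notin> copy i ` F" using Y by blast
    then obtain k x where kx: "k < m" "x \<in> F" "y = copy k x" using Y by (auto simp: C_def)
    then have ki: "k \<noteq> i" using y by auto
    have pi: "part Y i = F" using Y by (auto simp: part_def)
    have "part Y k \<noteq> {}" using kx y by (auto simp: part_def)
    then have pk: "1 \<le> delta E (part Y k)"
      by (rule sparse_delta_pos[OF sparse_F part_subset finite_part])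
    have "delta E (part Y i) + delta E (part Y k) = (\<Sum>j\<in>{i, k}. delta E (part Y j))"
      using ki by auto
    also have "\<dots> \<le> (\<Sum>j<m. delta E (part Y j))"
      by (rule sum_mono2) (use i kx(1) sparseD(1)[OF sparse_F part_subset finite_part] in auto)
    also have "\<dots> = delta edges Y"
      using delta_edges_no_link[OF 3] delta_copied Y by simp
    finally show ?thesis using pi pk by simp
  qed
  then show "delta edges (copy i ` F) < delta edges Y" using delta_copy[OF i] by simp
qed

lemma embeds_copy:
  assumes i: "i < m"
  shows "embeds E F edges (copy i)"
  unfolding embeds_def
proof (intro conjI allI impI inj_copy)
  fix e assume e: "e \<subseteq> F"
  have "copy i ` e \<notin> links" using link_not_in_copy e by blast
  moreover have "copy i ` e \<in> copied \<longleftrightarrow> e \<in> E"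
  proof
    assume "copy i ` e \<in> copied"
    then obtain j e' where j: "e' \<in> E" "copy i ` e = copy j ` e'"
      by (auto simp: copied_def edges_in_def)
    then obtain x where "x \<in> e'" using no_empty_edge by (metis ex_in_conv)
    then have "copy j x \<in> copy i ` e" using j by auto
    then have "i = j" by auto
    then have "e = e'" using j(2) by (simp add: inj_image_eq_iff inj_copy)
    then show "e \<in> E" using j(1) by simp
  next
    assume "e \<in> E"
    then show "copy i ` e \<in> copied" using i e by (auto simp: copied_def edges_in_def)
  qed
  ultimately show "copy i ` e \<in> edges \<longleftrightarrow> e \<in> E" by (simp add: edges_def)
qed

end

section \<open>The linked copies realised in the generic hypergraph\<close>

context generic_structure
begin

text \<open>The abstract structure \<open>C\<close> is embedded strongly over the empty set. Each
  copy of \<open>F\<close> is strong in \<open>C\<close>, hence in \<open>X\<close>, and homogeneity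
  makes it a translate of \<open>F\<close> by an automorphism.\<close>

theorem linked_copies_exist:
  assumes F: "finite F" "F \<noteq> {}" "strong E F X"
  obtains m :: nat and h where "\<And>j. j < m \<Longrightarrow> h j \<in> aut"
    "\<And>i j. i < m \<Longrightarrow> j < m \<Longrightarrow> i \<noteq> j \<Longrightarrow> h i ` F \<inter> h j ` F = {}"
    "delta E (\<Union>j<m. h j ` F) < int m"
    "\<And>e. e \<in> E \<Longrightarrow> e \<subseteq> (\<Union>j<m. h j ` F) \<Longrightarrow> (\<exists>j<m. e \<subseteq> h j ` F) \<or> K < card e"
proof -
  \<comment> \<open>The summand \<open>K\<close> makes the links large: they have
    \<open>m * card F - 1\<close> points, which is at least \<open>m - 1 > K\<close>.\<close>
  define m where "m = card F + K + 10"
  interpret linked_copies E F m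
    using F sparse_subset[OF sparse strong_subsetD[OF F(3)]] by unfold_locales (auto simp: m_def)
  have "\<exists>f. (\<forall>x\<in>{}. f x = id x) \<and> embeds edges C E f \<and> strong E (f ` C) X"
  proof (rule extension)
    show "embeds edges {} E id"
      using sparse_no_empty_edge[OF sparse] sparse_no_empty_edge[OF sparse_edges]
      by (simp add: embeds_def)
  qed (use finite_C sparse_edges strong_empty[OF sparse_edges] strong_empty[OF sparse] in auto)
  then obtain f where f: "embeds edges C E f" "strong E (f ` C) X" by blast
  have copy_C: "copy j ` F \<subseteq> C" if "j < m" for j using that by (auto simp: C_def)
  have "\<exists>g\<in>aut. \<forall>x\<in>F. g x = f (copy j x)" if j: "j < m" for j
  proof -
    have im: "(f \<circ> copy j) ` F = f ` copy j ` F" by (simp add: image_comp)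
    have "strong E (f ` copy j ` F) (f ` C)"
      using strong_image[OF f(1) copy_C[OF j]] strong_copy[OF j] by simp
    then have "strong E ((f \<circ> copy j) ` F) X"
      unfolding im by (rule strong_trans[OF _ f(2)]) (simp add: finite_C)
    then have "partial_iso F (f \<circ> copy j)"
      using F embeds_comp[OF embeds_copy[OF j] f(1) copy_C[OF j]] by (simp add: partial_iso_def)
    then show ?thesis using partial_iso_extends[of F "f \<circ> copy j"] by (metis comp_apply)
  qed
  then obtain h where h: "\<And>j. j < m \<Longrightarrow> h j \<in> aut" "\<And>j x. j < m \<Longrightarrow> x \<in> F \<Longrightarrow> h j x = f (copy j x)"
    by metis
  have him: "h j ` F = f ` copy j ` F" if "j < m" for j using h(2)[OF that] by (auto simp: image_iff)
  have C: "(\<Union>j<m. h j ` F) = f ` C" using him by (auto simp: C_def)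
  show ?thesis
  proof (rule that[of m h])
    show "h j \<in> aut" if "j < m" for j using h(1)[OF that] .
    show "h i ` F \<inter> h j ` F = {}" if ij: "i < m" "j < m" "i \<noteq> j" for i j
    proof -
      have "copy i ` F \<inter> copy j ` F = {}" using ij(3) by auto
      then show ?thesis
        using inj_on_image_Int[OF embedsD(1)[OF f(1)] copy_C[OF ij(1)] copy_C[OF ij(2)]]
        by (simp add: him ij)
    qed
    have "delta E (f ` C) = delta edges C" using delta_image[OF f(1)] by simp
    then show "delta E (\<Union>j<m. h j ` F) < int m" using delta_edges_C by (simp add: C)
    fix e assume e: "e \<in> E" "e \<subseteq> (\<Union>j<m. h j ` F)"
    then obtain e0 where e0: "e0 \<subseteq> C" "e = f ` e0" by (auto simp: C subset_image_iff)
    then have "e0 \<in> edges" using e(1) embedsD(2)[OF f(1) e0(1)] by simp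
    then consider "e0 \<in> copied" | "e0 \<in> links" by (auto simp: edges_def)
    then show "(\<exists>j<m. e \<subseteq> h j ` F) \<or> K < card e"
    proof cases
      case 1
      then obtain j where "j < m" "e0 \<subseteq> copy j ` F" using copied_in_copy by blast
      then show ?thesis using e0(2) him by blast
    next
      case 2
      then obtain v where v: "v \<in> C" "e0 = C - {v}" using links_subset by blast
      have "card e = card e0"
        using e0 embedsD(1)[OF f(1)] by (simp add: card_image inj_on_subset)
      also have "\<dots> = m * card F - 1" using v finite_C card_C by simp
      also have "\<dots> > K"
      proof -
        have "1 \<le> card F" using F by (simp add: Suc_leI card_gt_0_iff)
        then have "m * 1 \<le> m * card F" by (rule mult_le_mono2)
        then show ?thesis using m_def by linarith
      qed
      finally show ?thesis by simp
    qed
  qed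
qed

end

section \<open>Minimal subflows\<close>

text \<open>Only inclusion is assumed; the inverse element gives equality. \<open>restrict\<close>
  is there because members of \<open>Bij B\<close> are extensional.\<close>

lemma group_action_restrict:
  assumes act: "group_action H A \<phi>" and B: "B \<subseteq> A"
    and inv: "\<And>g. g \<in> carrier H \<Longrightarrow> \<phi> g ` B \<subseteq> B"
  shows "group_action H B (\<lambda>g. restrict (\<phi> g) B)"
proof -
  interpret group_action H A \<phi> by (rule act)
  interpret H: group H using group_hom by (simp add: group_hom_def)
  have Bij: "restrict (\<phi> g) B \<in> Bij B" if g: "g \<in> carrier H" for g
  proof -
    have "inj_on (\<phi> g) A" using inj_prop[OF g] .
    then have "inj_on (\<phi> g) B" using B by (rule inj_on_subset)
    moreover have "\<phi> g ` B = B"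
    proof
      show "B \<subseteq> \<phi> g ` B"
      proof
        fix y assume y: "y \<in> B"
        have ig: "inv\<^bsub>H\<^esub> g \<in> carrier H" using g by simp
        have "y = \<phi> g (\<phi> (inv\<^bsub>H\<^esub> g) y)"
          using composition_rule[of y g "inv\<^bsub>H\<^esub> g"] y B g ig id_eq_one[symmetric] by auto
        moreover have "\<phi> (inv\<^bsub>H\<^esub> g) y \<in> B" using inv[OF ig] y by auto
        ultimately show "y \<in> \<phi> g ` B" by blast
      qed
    qed (rule inv[OF g])
    ultimately show ?thesis by (simp add: Bij_def bij_betw_def)
  qed
  have "(\<lambda>g. restrict (\<phi> g) B) \<in> hom H (BijGroup B)"
  proof (rule homI)
    show "restrict (\<phi> g) B \<in> carrier (BijGroup B)" if "g \<in> carrier H" for g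
      using Bij[OF that] by (simp add: BijGroup_def)
    fix g h assume gh: "g \<in> carrier H" "h \<in> carrier H"
    have "restrict (\<phi> (g \<otimes>\<^bsub>H\<^esub> h)) B = compose B (restrict (\<phi> g) B) (restrict (\<phi> h) B)"
    proof
      fix x
      show "restrict (\<phi> (g \<otimes>\<^bsub>H\<^esub> h)) B x = compose B (restrict (\<phi> g) B) (restrict (\<phi> h) B) x"
        using composition_rule[of x g h] gh B inv[OF gh(2)] by (auto simp: compose_def)
    qed
    then show "restrict (\<phi> (g \<otimes>\<^bsub>H\<^esub> h)) B =
        restrict (\<phi> g) B \<otimes>\<^bsub>BijGroup B\<^esub> restrict (\<phi> h) B"
      using Bij gh by (simp add: BijGroup_def)
  qed
  then show ?thesis
    by (simp add: group_action_def group_hom_def group_hom_axioms_def H.is_group group_BijGroup)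
qed

lemma continuous_map_flow:
  assumes "flow G X Y \<phi>" "G \<subseteq> Bij X" "g \<in> G"
  shows "continuous_map Y Y (\<phi> g)"
proof -
  have "continuous_map Y (prod_topology (subtopology (sym_topology X) G) Y) (\<lambda>y. (g, y))"
    using assms by (intro continuous_map_pairedI) (auto simp: topspace_sym_topology)
  from continuous_map_compose[OF this] assms(1) show ?thesis
    by (force simp: flow_def comp_def)
qed

lemma flow_restrict:
  assumes flow: "flow G X Y \<phi>" and Z: "closedin Y Z" "Z \<noteq> {}"
    and inv: "\<And>g. g \<in> G \<Longrightarrow> \<phi> g ` Z \<subseteq> Z"
  shows "flow G X (subtopology Y Z) (\<lambda>g. restrict (\<phi> g) Z)"
proof -
  let ?T = "subtopology (sym_topology X) G"
  have ZY: "Z \<subseteq> topspace Y" using Z(1) by (rule closedin_subset)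
  then have top: "topspace (subtopology Y Z) = Z" by auto
  have "continuous_map (prod_topology ?T Y) Y (\<lambda>(g, y). \<phi> g y)" using flow by (simp add: flow_def)
  then have "continuous_map (subtopology (prod_topology ?T Y) (topspace ?T \<times> Z)) Y (\<lambda>(g, y). \<phi> g y)"
    by (rule continuous_map_from_subtopology)
  then have "continuous_map (prod_topology ?T (subtopology Y Z)) Y (\<lambda>(g, y). \<phi> g y)"
    unfolding prod_topology_subtopology(2) .
  then have "continuous_map (prod_topology ?T (subtopology Y Z)) Y (\<lambda>(g, y). restrict (\<phi> g) Z y)"
    by (rule continuous_map_eq) (auto simp: top)
  then have "continuous_map (prod_topology ?T (subtopology Y Z)) (subtopology Y Z)
      (\<lambda>(g, y). restrict (\<phi> g) Z y)"
    unfolding continuous_map_in_subtopology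
  proof (intro conjI Pi_I)
    fix p assume "p \<in> topspace (prod_topology ?T (subtopology Y Z))"
    then obtain g y where "p = (g, y)" "g \<in> G" "y \<in> Z" by auto
    then show "(case p of (g, y) \<Rightarrow> restrict (\<phi> g) Z y) \<in> Z" using inv[of g] by auto
  qed
  moreover have "group_action (permgroup G X) Z (\<lambda>g. restrict (\<phi> g) Z)"
    using flow ZY inv by (intro group_action_restrict[of _ "topspace Y"]) (auto simp: flow_def)
  moreover have "compact_space (subtopology Y Z)"
    using flow Z(1) closedin_compact_space compact_space_subtopology by (auto simp: flow_def)
  moreover have "Hausdorff_space (subtopology Y Z)"
    using flow by (auto simp: flow_def Hausdorff_space_subtopology)
  ultimately show ?thesis using Z(2) unfolding flow_def top by blast
qed

text \<open>Zorn's lemma for complements: a maximal proper open set with invariant complement. If a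
  chain covered the space, compactness would give a finite subcover, and its largest member would
  already be everything.\<close>

theorem minimal_subflow_exists:
  assumes flow: "flow G X Y \<phi>" and G: "G \<subseteq> Bij X"
  obtains Z where "closedin Y Z" "Z \<noteq> {}" "\<And>g. g \<in> G \<Longrightarrow> \<phi> g ` Z \<subseteq> Z"
    "minimal_flow G X (subtopology Y Z) (\<lambda>g. restrict (\<phi> g) Z)"
proof -
  interpret group_action "permgroup G X" "topspace Y" \<phi> using flow by (simp add: flow_def)
  interpret H: group "permgroup G X" using group_hom by (simp add: group_hom_def)
  define \<U> where "\<U> = {U. openin Y U \<and> U \<noteq> topspace Y \<and>
     (\<forall>g\<in>G. \<phi> g ` (topspace Y - U) \<subseteq> topspace Y - U)}"
  have Y_nonempty: "topspace Y \<noteq> {}" using flow unfolding flow_def by blast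
  have mem: "\<phi> g y \<in> topspace Y" if "g \<in> G" "y \<in> topspace Y" for g y
    using element_image[of g y] that by simp
  have "\<exists>U\<in>\<U>. \<forall>V\<in>\<U>. U \<subseteq> V \<longrightarrow> V = U"
  proof (rule subset_Zorn_nonempty)
    have "{} \<in> \<U>"
      unfolding \<U>_def using openin_empty[of Y] Y_nonempty[symmetric] mem by blast
    then show "\<U> \<noteq> {}" by blast
    fix \<C> assume C: "\<C> \<noteq> {}" "subset.chain \<U> \<C>"
    then have CU: "\<C> \<subseteq> \<U>" by (simp add: subset.chain_def)
    have "\<Union>\<C> \<noteq> topspace Y"
    proof
      assume eq: "\<Union>\<C> = topspace Y"
      have "compactin Y (topspace Y)" using flow by (simp add: flow_def compact_space_def)
      moreover have "\<forall>U\<in>\<C>. openin Y U" using CU by (auto simp: \<U>_def)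
      ultimately obtain \<F> where F: "finite \<F>" "\<F> \<subseteq> \<C>" "topspace Y \<subseteq> \<Union>\<F>"
        using eq unfolding compactin_def by (metis subset_refl)
      have "\<F> \<noteq> {}" using F(3) Y_nonempty by auto
      moreover have "subset.chain \<U> \<F>" using C(2) F(2) unfolding subset.chain_def by (meson subset_trans subsetD)
      ultimately have "\<Union>\<F> \<in> \<F>" using F(1) by (intro Union_in_chain)
      then have "\<Union>\<F> \<in> \<U>" using F(2) CU by blast
      then have "openin Y (\<Union>\<F>)" "\<Union>\<F> \<noteq> topspace Y" by (auto simp: \<U>_def)
      then show False using F(3) openin_subset by blast
    qed
    moreover have "openin Y (\<Union>\<C>)" using CU by (auto simp: \<U>_def)
    moreover have "\<phi> g ` (topspace Y - \<Union>\<C>) \<subseteq> topspace Y - \<Union>\<C>" if "g \<in> G" for g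
      using CU that mem by (fastforce simp: \<U>_def)
    ultimately show "\<Union>\<C> \<in> \<U>" by (simp add: \<U>_def)
  qed
  then obtain U where U: "U \<in> \<U>" and max: "\<And>V. V \<in> \<U> \<Longrightarrow> U \<subseteq> V \<Longrightarrow> V = U" by blast
  define Z where "Z = topspace Y - U"
  have Z: "closedin Y Z" using U by (auto simp: \<U>_def Z_def)
  have ZY: "Z \<subseteq> topspace Y" by (auto simp: Z_def)
  have Zne: "Z \<noteq> {}" using U openin_subset[of Y U] by (auto simp: \<U>_def Z_def)
  have inv: "\<phi> g ` Z \<subseteq> Z" if "g \<in> G" for g using U that by (simp add: \<U>_def Z_def)
  have "minimal_flow G X (subtopology Y Z) (\<lambda>g. restrict (\<phi> g) Z)"
    unfolding minimal_flow_def
  proof (intro conjI ballI flow_restrict[OF flow Z Zne inv])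
    fix z assume "z \<in> topspace (subtopology Y Z)"
    then have z: "z \<in> Z" by simp
    define K where "K = Y closure_of ((\<lambda>g. \<phi> g z) ` G)"
    have orb: "orbit (permgroup G X) (\<lambda>g. restrict (\<phi> g) Z) z = (\<lambda>g. \<phi> g z) ` G"
      using z by (auto simp: orbit_def)
    have sub: "(\<lambda>g. \<phi> g z) ` G \<subseteq> Z" using inv z by auto
    have KZ: "K \<subseteq> Z" unfolding K_def using sub Z by (rule closure_of_minimal)
    have "z \<in> (\<lambda>g. \<phi> g z) ` G"
    proof (rule image_eqI)
      show "z = \<phi> \<one>\<^bsub>permgroup G X\<^esub> z" using id_eq_one[symmetric] z ZY by auto
      show "\<one>\<^bsub>permgroup G X\<^esub> \<in> G" using H.one_closed by simp
    qed
    then have zK: "z \<in> K"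
      unfolding K_def using closure_of_subset[of "(\<lambda>g. \<phi> g z) ` G" Y] sub ZY by blast
    have "\<phi> g ` K \<subseteq> K" if g: "g \<in> G" for g
    proof -
      have "\<phi> g ` K \<subseteq> Y closure_of (\<phi> g ` (\<lambda>g. \<phi> g z) ` G)"
        unfolding K_def
        by (rule continuous_map_image_closure_subset[OF continuous_map_flow[OF flow G g]])
      also have "\<dots> \<subseteq> K"
        unfolding K_def
      proof (rule closure_of_mono, clarify)
        fix h assume h: "h \<in> G"
        have "\<phi> g (\<phi> h z) = \<phi> (g \<otimes>\<^bsub>permgroup G X\<^esub> h) z"
          using composition_rule[of z g h] z ZY g h by auto
        moreover have "g \<otimes>\<^bsub>permgroup G X\<^esub> h \<in> G" using H.m_closed[of g h] g h by simp
        ultimately show "\<phi> g (\<phi> h z) \<in> (\<lambda>g. \<phi> g z) ` G" by blast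
      qed
      finally show ?thesis .
    qed
    moreover have KY: "topspace Y - (topspace Y - K) = K" using KZ ZY by auto
    moreover have "closedin Y K" by (simp add: K_def)
    \<comment> \<open>The orbit closure \<open>K\<close> is nonempty, closed and invariant, so its
      complement competes with \<open>U\<close>; maximality yields \<open>K = Z\<close>.\<close>
    ultimately have "topspace Y - K \<in> \<U>" using zK z ZY unfolding \<U>_def by auto
    moreover have "U \<subseteq> topspace Y - K"
      using U openin_subset[of Y U] KZ by (auto simp: \<U>_def Z_def)
    ultimately have "topspace Y - K = U" by (rule max)
    then have "K = Z" using KY by (simp add: Z_def)
    then show "subtopology Y Z closure_of orbit (permgroup G X) (\<lambda>g. restrict (\<phi> g) Z) z
        = topspace (subtopology Y Z)"
      unfolding orb closure_of_subtopology using sub ZY by (simp add: K_def Int_absorb1)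
  qed
  then show ?thesis using Z Zne inv that by blast
qed

section \<open>The flow of orientations\<close>

text \<open>Hall's theorem by the Halmos-Vaughan induction. If some proper nonempty subfamily is
  tight, it is matched first and the rest is matched outside its union. Otherwise every proper
  nonempty subfamily has a spare element, so one index can be given any of its elements.\<close>

theorem marriage:
  assumes "finite I" "\<And>i. i \<in> I \<Longrightarrow> finite (S i)"
    "\<And>J. J \<subseteq> I \<Longrightarrow> card J \<le> card (\<Union> (S ` J))"
  shows "\<exists>r. inj_on r I \<and> (\<forall>i\<in>I. r i \<in> S i)"
  using assms
proof (induction "card I" arbitrary: I S rule: less_induct)
  case less
  note fin = less.prems(1,2) and hall = less.prems(3)
  have finU: "finite (\<Union> (S ` J))" if "J \<subseteq> I" for J
    using that fin finite_subset by blast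
  show ?case
  proof (cases "\<exists>J. J \<subseteq> I \<and> J \<noteq> {} \<and> J \<noteq> I \<and> card J = card (\<Union> (S ` J))")
    case True
    then obtain J where J: "J \<subseteq> I" "J \<noteq> {}" "J \<noteq> I" "card J = card (\<Union> (S ` J))" by blast
    let ?U = "\<Union> (S ` J)"
    have finJ: "finite J" using J(1) fin(1) by (rule finite_subset)
    have "card J < card I" using J fin(1) by (intro psubset_card_mono) auto
    moreover have "card K \<le> card (\<Union> (S ` K))" if "K \<subseteq> J" for K
      using hall that J(1) by blast
    ultimately obtain r1 where r1: "inj_on r1 J" "\<forall>i\<in>J. r1 i \<in> S i"
      using less.hyps[of J S] finJ fin(2) J(1) by blast
    have "card (I - J) < card I"
      using J fin(1) by (intro psubset_card_mono) auto
    moreover have "card K \<le> card (\<Union> ((\<lambda>i. S i - ?U) ` K))" if K: "K \<subseteq> I - J" for K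
    proof -
      have finK: "finite K" using K fin(1) finite_subset by blast
      have KU: "finite (\<Union> ((\<lambda>i. S i - ?U) ` K))"
        by (rule finite_subset[OF _ finU[of K]]) (use K in auto)
      have "card K + card J = card (K \<union> J)"
        using K finK finJ by (intro card_Un_disjoint[symmetric]) auto
      also have "\<dots> \<le> card (\<Union> (S ` (K \<union> J)))" using K J(1) by (intro hall) auto
      also have "\<Union> (S ` (K \<union> J)) = \<Union> ((\<lambda>i. S i - ?U) ` K) \<union> ?U" by auto
      also have "card \<dots> = card (\<Union> ((\<lambda>i. S i - ?U) ` K)) + card ?U"
        using KU finU[OF J(1)] by (intro card_Un_disjoint) auto
      finally show ?thesis using J(4) by simp
    qed
    ultimately obtain r2 where r2: "inj_on r2 (I - J)" "\<forall>i\<in>I - J. r2 i \<in> S i - ?U"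
      using less.hyps[of "I - J" "\<lambda>i. S i - ?U"] fin(1) finite_Diff[OF fin(2), of _ ?U]
      by (metis (no_types, lifting) Diff_iff finite_Diff)
    let ?r = "\<lambda>i. if i \<in> J then r1 i else r2 i"
    have "inj_on ?r I"
    proof (rule inj_onI)
      fix i k assume ik: "i \<in> I" "k \<in> I" "?r i = ?r k"
      have cross: False if "p \<in> J" "q \<in> I - J" "r1 p = r2 q" for p q
        using that r1(2) r2(2) by (metis DiffD2 UN_I)
      show "i = k"
        using ik cross[of i k] cross[of k i] inj_onD[OF r1(1), of i k] inj_onD[OF r2(1), of i k]
        by (auto split: if_splits)
    qed
    moreover have "\<forall>i\<in>I. ?r i \<in> S i" using r1(2) r2(2) by auto
    ultimately show ?thesis by blast
  next
    case False
    show ?thesis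
    proof (cases "I = {}")
      case True
      then show ?thesis by simp
    next
      case I: False
      then obtain i where i: "i \<in> I" by blast
      have "card {i} \<le> card (\<Union> (S ` {i}))" using i by (intro hall) auto
      then obtain x where x: "x \<in> S i" by (cases "S i = {}") auto
      have "card (I - {i}) < card I" using i fin(1) by (rule card_Diff1_less[rotated])
      moreover have "card K \<le> card (\<Union> ((\<lambda>i. S i - {x}) ` K))" if K: "K \<subseteq> I - {i}" for K
      proof (cases "K = {}")
        case K': False
        have KI: "K \<subseteq> I" "K \<noteq> I" using K i by auto
        have "card K \<noteq> card (\<Union> (S ` K))" using False KI K' by blast
        then have "card K < card (\<Union> (S ` K))" using hall[OF KI(1)] by simp
        moreover have "card (\<Union> (S ` K)) - 1 \<le> card (\<Union> (S ` K) - {x})"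
          by (simp add: card_Diff_singleton_if)
        moreover have eq: "\<Union> ((\<lambda>i. S i - {x}) ` K) = \<Union> (S ` K) - {x}" by auto
        ultimately show ?thesis unfolding eq by linarith
      qed simp
      ultimately obtain r where r: "inj_on r (I - {i})" "\<forall>j\<in>I - {i}. r j \<in> S j - {x}"
        using less.hyps[of "I - {i}" "\<lambda>i. S i - {x}"] fin(1) finite_Diff[OF fin(2), of _ "{x}"]
        by (metis (no_types, lifting) Diff_iff finite_Diff)
      let ?r = "r(i := x)"
      have "inj_on ?r I" using r by (auto simp: inj_on_def)
      moreover have "\<forall>j\<in>I. ?r j \<in> S j" using r(2) x by auto
      ultimately show ?thesis by blast
    qed
  qed
qed

lemma group_actionI:
  assumes "group H"
    and ext: "\<And>g. g \<in> carrier H \<Longrightarrow> \<phi> g \<in> extensional A"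
    and closed: "\<And>g x. g \<in> carrier H \<Longrightarrow> x \<in> A \<Longrightarrow> \<phi> g x \<in> A"
    and one: "\<And>x. x \<in> A \<Longrightarrow> \<phi> \<one>\<^bsub>H\<^esub> x = x"
    and mult: "\<And>g h x. g \<in> carrier H \<Longrightarrow> h \<in> carrier H \<Longrightarrow> x \<in> A \<Longrightarrow> \<phi> (g \<otimes>\<^bsub>H\<^esub> h) x = \<phi> g (\<phi> h x)"
  shows "group_action H A \<phi>"
proof -
  interpret H: group H by fact
  have Bij: "\<phi> g \<in> Bij A" if g: "g \<in> carrier H" for g
  proof -
    have ig: "inv\<^bsub>H\<^esub> g \<in> carrier H" using g by simp
    have "bij_betw (\<phi> g) A A"
    proof (rule bij_betw_byWitness[of _ "\<phi> (inv\<^bsub>H\<^esub> g)"])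
      show "\<forall>x\<in>A. \<phi> (inv\<^bsub>H\<^esub> g) (\<phi> g x) = x"
        using mult[OF ig g] one g by simp
      show "\<forall>x\<in>A. \<phi> g (\<phi> (inv\<^bsub>H\<^esub> g) x) = x"
        using mult[OF g ig] one g by simp
    qed (use closed g ig in auto)
    then show ?thesis using ext[OF g] by (simp add: Bij_def)
  qed
  have "\<phi> \<in> hom H (BijGroup A)"
  proof (rule homI)
    show "\<phi> g \<in> carrier (BijGroup A)" if "g \<in> carrier H" for g
      using Bij[OF that] by (simp add: BijGroup_def)
    fix g h assume gh: "g \<in> carrier H" "h \<in> carrier H"
    have "\<phi> (g \<otimes>\<^bsub>H\<^esub> h) = compose A (\<phi> g) (\<phi> h)"
    proof (rule extensionalityI[of _ A])
      show "\<phi> (g \<otimes>\<^bsub>H\<^esub> h) \<in> extensional A" using gh by (intro ext) simp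
    qed (use mult gh in \<open>auto simp: compose_def\<close>)
    then show "\<phi> (g \<otimes>\<^bsub>H\<^esub> h) = \<phi> g \<otimes>\<^bsub>BijGroup A\<^esub> \<phi> h"
      using Bij gh by (simp add: BijGroup_def)
  qed
  then show ?thesis
    by (simp add: group_action_def group_hom_def group_hom_axioms_def H.is_group group_BijGroup)
qed

lemma openin_sym_subtopologyI:
  assumes G: "G \<subseteq> Bij X" and U: "U \<subseteq> G"
    and loc: "\<And>g. g \<in> U \<Longrightarrow> \<exists>J. finite J \<and> J \<subseteq> X \<and> (\<forall>h\<in>G. (\<forall>j\<in>J. h j = g j) \<longrightarrow> h \<in> U)"
  shows "openin (subtopology (sym_topology X) G) U"
proof -
  obtain J where J: "\<And>g. g \<in> U \<Longrightarrow> finite (J g) \<and> J g \<subseteq> X \<and> (\<forall>h\<in>G. (\<forall>j\<in>J g. h j = g j) \<longrightarrow> h \<in> U)"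
    using loc by metis
  define V where "V = {f \<in> X \<rightarrow>\<^sub>E X. \<exists>g\<in>U. \<forall>j\<in>J g. f j = g j}"
  have "openin (product_topology (\<lambda>_. discrete_topology X) X) V"
    unfolding openin_product_discrete_iff
  proof (intro conjI ballI)
    fix f assume "f \<in> V"
    then obtain g where "g \<in> U" "\<forall>j\<in>J g. f j = g j" by (auto simp: V_def)
    then show "\<exists>J. finite J \<and> J \<subseteq> X \<and> (\<forall>h\<in>X \<rightarrow>\<^sub>E X. (\<forall>j\<in>J. h j = f j) \<longrightarrow> h \<in> V)"
      using J[of g] by (intro exI[of _ "J g"]) (auto simp: V_def)
  qed (auto simp: V_def)
  moreover have "U = V \<inter> Bij X \<inter> G"
  proof
    show "U \<subseteq> V \<inter> Bij X \<inter> G"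
    proof
      fix g assume g: "g \<in> U"
      then have b: "g \<in> Bij X" using G U by blast
      then have "g \<in> X \<rightarrow>\<^sub>E X" using Bij_imp_funcset Bij_imp_extensional by (auto simp: PiE_def)
      then show "g \<in> V \<inter> Bij X \<inter> G" using g b U by (auto simp: V_def)
    qed
    show "V \<inter> Bij X \<inter> G \<subseteq> U"
      using J by (auto simp: V_def)
  qed
  ultimately show ?thesis
    unfolding sym_topology_def openin_subtopology by blast
qed

section \<open>Orientations coded as points of a Cantor cube\<close>

abbreviation cantor_cube :: "(nat \<Rightarrow> real) topology" where
  "cantor_cube \<equiv> product_topology (\<lambda>_. discrete_topology {0, 1}) UNIV"

text \<open>The index of the coordinate that records whether the edge \<open>e\<close> owns
  \<open>x\<close>. \<open>set_encode\<close> is injective only on finite sets, which covers all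
  edges.\<close>

definition slot :: "nat \<Rightarrow> nat set \<Rightarrow> nat" where
  "slot x e = prod_encode (x, set_encode e)"

lemma slot_eq_iff: "finite e \<Longrightarrow> finite e' \<Longrightarrow> slot x e = slot x' e' \<longleftrightarrow> x = x' \<and> e = e'"
  by (simp add: slot_def set_encode_eq)

context generic_structure
begin

definition owns :: "(nat \<Rightarrow> real) \<Rightarrow> nat \<Rightarrow> nat set \<Rightarrow> bool" where
  "owns y x e \<longleftrightarrow> e \<in> E \<and> x \<in> e \<and> y (slot x e) = 1"

text \<open>Relative to a set \<open>D\<close> of edges, so that Hall's theorem can be applied to
  finite \<open>D\<close> before compactness gives \<open>D = E\<close>.\<close>

definition orients :: "(nat \<Rightarrow> real) \<Rightarrow> nat set set \<Rightarrow> bool" where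
  "orients y D \<longleftrightarrow> (\<forall>e\<in>D. \<exists>!x. owns y x e) \<and>
     (\<forall>e\<in>D. \<forall>e'\<in>D. \<forall>x. owns y x e \<longrightarrow> owns y x e' \<longrightarrow> e = e')"

text \<open>Coordinates that belong to no incident pair of a point and an edge are unconstrained, so
  a member carries free bits beyond its orientation.\<close>

definition orientations :: "(nat \<Rightarrow> real) set" where
  "orientations = {y \<in> topspace cantor_cube. orients y E}"

text \<open>The permutation of coordinates induced by \<open>g\<close>; indices that do not code a
  point and a subset of \<open>X\<close> stay fixed.\<close>

definition shift :: "(nat \<Rightarrow> nat) \<Rightarrow> nat \<Rightarrow> nat" where
  "shift g k = (case prod_decode k of (x, s) \<Rightarrow>
     if x \<in> X \<and> set_decode s \<subseteq> X then slot (g x) (g ` set_decode s) else k)"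

lemma orientsI:
  assumes "\<And>e. e \<in> D \<Longrightarrow> \<exists>!x. owns y x e"
    and "\<And>e e' x. e \<in> D \<Longrightarrow> e' \<in> D \<Longrightarrow> owns y x e \<Longrightarrow> owns y x e' \<Longrightarrow> e = e'"
  shows "orients y D"
  using assms by (simp add: orients_def)

lemma orients_subset: "orients y D \<Longrightarrow> D' \<subseteq> D \<Longrightarrow> orients y D'"
  by (simp add: orients_def subset_iff)

text \<open>Each of the two conditions involves at most two edges at a time.\<close>

lemma orients_finitary:
  assumes "\<And>L. finite L \<Longrightarrow> L \<subseteq> D \<Longrightarrow> orients y L"
  shows "orients y D"
proof (rule orientsI)
  show "\<exists>!x. owns y x e" if "e \<in> D" for e
    using assms[of "{e}"] that by (simp add: orients_def)
  show "e = e'" if "e \<in> D" "e' \<in> D" "owns y x e" "owns y x e'" for e e' x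
    using assms[of "{e, e'}"] that by (simp add: orients_def)
qed

lemma shift_slot:
  assumes "x \<in> X" "finite e" "e \<subseteq> X"
  shows "shift g (slot x e) = slot (g x) (g ` e)"
  using assms by (simp add: shift_def slot_def)

lemma shift_cases:
  obtains x e where "x \<in> X" "finite e" "e \<subseteq> X" "k = slot x e" | "\<And>g. shift g k = k"
proof (cases "\<exists>x s. prod_decode k = (x, s) \<and> x \<in> X \<and> set_decode s \<subseteq> X")
  case True
  then obtain x s where xs: "prod_decode k = (x, s)" "x \<in> X" "set_decode s \<subseteq> X" by blast
  then have "k = slot x (set_decode s)"
    unfolding slot_def set_decode_inverse by (metis prod_decode_inverse)
  then show ?thesis using that(1)[of x "set_decode s"] xs finite_set_decode by blast
next
  case False
  have "shift g k = k" for g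
    using False by (cases "prod_decode k") (auto simp: shift_def)
  then show ?thesis by (rule that(2))
qed

abbreviation autgroup :: "(nat \<Rightarrow> nat) monoid" where "autgroup \<equiv> permgroup aut X"

lemma group_autgroup: "group autgroup"
  unfolding permgroup_def
  using subgroup.subgroup_is_group[OF subgroup_aut group_BijGroup] by simp

interpretation autgroup: group autgroup by (rule group_autgroup)

lemma aut_mult:
  "g \<in> aut \<Longrightarrow> h \<in> aut \<Longrightarrow> x \<in> X \<Longrightarrow> (g \<otimes>\<^bsub>autgroup\<^esub> h) x = g (h x)"
  using aut_Bij by (simp add: permgroup_def BijGroup_def compose_def)

lemma aut_one: "x \<in> X \<Longrightarrow> \<one>\<^bsub>autgroup\<^esub> x = x"
  by (simp add: permgroup_def BijGroup_def)

lemma inv_aut [simp]: "g \<in> aut \<Longrightarrow> inv\<^bsub>autgroup\<^esub> g \<in> aut"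
  using autgroup.inv_closed[of g] by simp

lemma aut_inv_left [simp]: "g \<in> aut \<Longrightarrow> x \<in> X \<Longrightarrow> (inv\<^bsub>autgroup\<^esub> g) (g x) = x"
  using aut_mult[of "inv\<^bsub>autgroup\<^esub> g" g x] aut_one[of x] autgroup.l_inv[of g] by simp

lemma aut_inv_right [simp]: "g \<in> aut \<Longrightarrow> x \<in> X \<Longrightarrow> g ((inv\<^bsub>autgroup\<^esub> g) x) = x"
  using aut_mult[of g "inv\<^bsub>autgroup\<^esub> g" x] aut_one[of x] autgroup.r_inv[of g] by simp

lemma aut_image_inv_left: "g \<in> aut \<Longrightarrow> e \<subseteq> X \<Longrightarrow> (inv\<^bsub>autgroup\<^esub> g) ` g ` e = e"
  by (force simp: image_iff)

lemma aut_image_inv_right: "g \<in> aut \<Longrightarrow> e \<subseteq> X \<Longrightarrow> g ` (inv\<^bsub>autgroup\<^esub> g) ` e = e"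
  by (force simp: image_iff)

lemma aut_inj: "g \<in> aut \<Longrightarrow> inj_on g X"
  using aut_Bij BijD(1) bij_betw_def by blast

lemma shift_mult:
  assumes "g \<in> aut" "h \<in> aut"
  shows "shift (g \<otimes>\<^bsub>autgroup\<^esub> h) k = shift g (shift h k)"
proof (cases rule: shift_cases[of k])
  case (1 x e)
  have "(g \<otimes>\<^bsub>autgroup\<^esub> h) ` e = g ` h ` e"
    using 1 aut_mult[OF assms] by (force simp: image_iff)
  moreover have "h x \<in> X" "h ` e \<subseteq> X" using 1 aut_mem[OF assms(2)] by auto
  ultimately show ?thesis using 1 aut_mult[OF assms] by (simp add: shift_slot)
next
  case 2
  then show ?thesis by simp
qed

lemma shift_one: "shift \<one>\<^bsub>autgroup\<^esub> k = k"
proof (cases rule: shift_cases[of k])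
  case (1 x e)
  have "\<one>\<^bsub>autgroup\<^esub> ` e = e" using 1 aut_one by (force simp: image_iff)
  then show ?thesis using 1 aut_one by (simp add: shift_slot)
qed simp

text \<open>Moving coordinates reverses the order of composition; the inverse restores a left
  action.\<close>

definition act :: "(nat \<Rightarrow> nat) \<Rightarrow> (nat \<Rightarrow> real) \<Rightarrow> nat \<Rightarrow> real" where
  "act g = (\<lambda>y\<in>orientations. \<lambda>k. y (shift (inv\<^bsub>autgroup\<^esub> g) k))"

lemma edge_image: "g \<in> aut \<Longrightarrow> e \<in> E \<Longrightarrow> g ` e \<in> E"
  using aut_edge edge by blast

lemma owns_shift:
  assumes "g \<in> aut" "x \<in> X" "finite e" "e \<subseteq> X"
  shows "owns (\<lambda>k. y (shift g k)) x e \<longleftrightarrow> owns y (g x) (g ` e)"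
proof -
  have "g x \<in> g ` e \<longleftrightarrow> x \<in> e" using aut_inj[OF assms(1)] assms by (auto simp: inj_on_eq_iff subset_iff)
  then show ?thesis using assms aut_edge[OF assms(1), of e] by (simp add: owns_def shift_slot)
qed

lemma owns_mem: "owns y x e \<Longrightarrow> x \<in> e \<and> e \<in> E \<and> finite e \<and> e \<subseteq> X \<and> x \<in> X"
  using edge by (auto simp: owns_def)

lemma orients_shift:
  assumes "orients y E" "g \<in> aut"
  shows "orients (\<lambda>k. y (shift g k)) E"
proof -
  let ?z = "\<lambda>k. y (shift g k)"
  have ow: "owns ?z x e \<longleftrightarrow> x \<in> X \<and> owns y (g x) (g ` e)" if "e \<in> E" for x e
    using owns_shift[OF assms(2), of x e] owns_mem[of ?z x e] edge[OF that] by blast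
  have "\<exists>!x. owns ?z x e" if e: "e \<in> E" for e
  proof -
    have "\<exists>!x. owns y x (g ` e)" using assms edge_image[OF assms(2) e] by (simp add: orients_def)
    then obtain w where w: "owns y w (g ` e)" "\<And>w'. owns y w' (g ` e) \<Longrightarrow> w' = w" by blast
    then obtain x where x: "x \<in> e" "w = g x" using owns_mem by blast
    then have xX: "x \<in> X" using edge[OF e] by blast
    show ?thesis
    proof (rule ex1I)
      show "owns ?z x e" using ow[OF e] xX x(2) w(1) by simp
      fix x' assume "owns ?z x' e"
      then have "x' \<in> X" "g x' = g x" using ow[OF e] w(2) x(2) by auto
      then show "x' = x" using inj_onD[OF aut_inj[OF assms(2)]] xX by blast
    qed
  qed
  moreover have "e = e'" if "e \<in> E" "e' \<in> E" "owns ?z x e" "owns ?z x e'" for e e' x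
  proof -
    have "g ` e = g ` e'"
      using that ow assms(1) edge_image[OF assms(2)] unfolding orients_def by blast
    then show ?thesis
      using inj_on_image_eq_iff[OF aut_inj[OF assms(2)]] edge that(1,2) by blast
  qed
  ultimately show ?thesis by (rule orientsI)
qed

lemma topspace_cantor_cube: "y \<in> topspace cantor_cube \<longleftrightarrow> (\<forall>k. y k = 0 \<or> y k = 1)"
  by (auto simp: PiE_iff)

lemma act_orientations:
  assumes "g \<in> aut" "y \<in> orientations"
  shows "act g y \<in> orientations"
proof -
  have "act g y \<in> topspace cantor_cube"
    using assms(2) unfolding topspace_cantor_cube orientations_def act_def by auto
  then show ?thesis
    using orients_shift[of y "inv\<^bsub>autgroup\<^esub> g"] assms by (simp add: orientations_def act_def)
qed

lemma owns_act:
  assumes g: "g \<in> aut" and y: "y \<in> orientations" and "x \<in> X" "finite e" "e \<subseteq> X"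
  shows "owns (act g y) (g x) (g ` e) \<longleftrightarrow> owns y x e"
proof -
  have "owns (act g y) (g x) (g ` e) \<longleftrightarrow>
      owns y ((inv\<^bsub>autgroup\<^esub> g) (g x)) ((inv\<^bsub>autgroup\<^esub> g) ` g ` e)"
    using owns_shift[of "inv\<^bsub>autgroup\<^esub> g" "g x" "g ` e" y] assms aut_mem[OF g]
    by (auto simp: act_def)
  then show ?thesis using aut_image_inv_left[OF g] assms by simp
qed

lemma group_action_act: "group_action autgroup orientations act"
proof (rule group_actionI[OF group_autgroup])
  show "act g \<in> extensional orientations" for g by (simp add: act_def)
  show "act g y \<in> orientations" if "g \<in> carrier autgroup" "y \<in> orientations" for g y
    using act_orientations that by simp
  show "act \<one>\<^bsub>autgroup\<^esub> y = y" if "y \<in> orientations" for y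
    using that by (simp add: act_def shift_one)
  fix g h y assume "g \<in> carrier autgroup" "h \<in> carrier autgroup" and y: "y \<in> orientations"
  then have g: "g \<in> aut" and h: "h \<in> aut" by simp_all
  have "inv\<^bsub>autgroup\<^esub> (g \<otimes>\<^bsub>autgroup\<^esub> h) = inv\<^bsub>autgroup\<^esub> h \<otimes>\<^bsub>autgroup\<^esub> inv\<^bsub>autgroup\<^esub> g"
    using g h by (intro autgroup.inv_mult_group) simp_all
  then show "act (g \<otimes>\<^bsub>autgroup\<^esub> h) y = act g (act h y)"
    using y act_orientations[OF h y] g h by (simp add: act_def shift_mult)
qed

text \<open>By \<open>orients_finitary\<close> a failure occurs on finitely many edges; these are
  finite, so finitely many coordinates reveal it.\<close>

lemma closedin_orients:
  assumes D: "D \<subseteq> E"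
  shows "closedin cantor_cube {y \<in> topspace cantor_cube. orients y D}"
proof -
  let ?C = "{y \<in> topspace cantor_cube. orients y D}"
  have same: "owns z x e \<longleftrightarrow> owns y x e" if "\<forall>k\<in>(\<lambda>x. slot x e) ` e. z k = y k" for y z x e
    using that by (auto simp: owns_def)
  have "openin cantor_cube (topspace cantor_cube - ?C)"
    unfolding openin_product_discrete_iff
  proof (intro conjI ballI)
    fix y assume y: "y \<in> topspace cantor_cube - ?C"
    then have "\<not> orients y D" by simp
    then obtain L where L: "finite L" "L \<subseteq> D" "\<not> orients y L"
      using orients_finitary by metis
    let ?J = "\<Union>e\<in>L. (\<lambda>x. slot x e) ` e"
    have J: "finite ?J" using L(1,2) D edge by blast
    have "z \<in> topspace cantor_cube - ?C"
      if z: "z \<in> UNIV \<rightarrow>\<^sub>E {0, 1}" "\<forall>k\<in>?J. z k = y k" for z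
    proof -
      have "owns z x e \<longleftrightarrow> owns y x e" if "e \<in> L" for x e
        by (rule same) (use z(2) that in blast)
      then have "\<not> orients z L" using L(3) unfolding orients_def by metis
      then have "\<not> orients z D" using L(2) orients_subset by blast
      then show ?thesis using z(1) by simp
    qed
    then show "\<exists>J. finite J \<and> J \<subseteq> UNIV \<and>
        (\<forall>z\<in>UNIV \<rightarrow>\<^sub>E {0, 1}. (\<forall>k\<in>J. z k = y k) \<longrightarrow> z \<in> topspace cantor_cube - ?C)"
      using J by (intro exI[of _ ?J] conjI ballI impI) simp_all
  qed auto
  then show ?thesis by (simp add: closedin_def)
qed

text \<open>Hall's condition is nonnegativity of the predimension: a family \<open>J\<close>
  consists of edges inside its union, which contains at most as many edges as points.\<close>

lemma finite_orientable:
  assumes D: "D \<subseteq> E" "finite D"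
  shows "\<exists>y\<in>topspace cantor_cube. orients y D"
proof -
  have "card J \<le> card (\<Union> (id ` J))" if J: "J \<subseteq> D" for J
  proof -
    have U: "finite (\<Union>J)" "\<Union>J \<subseteq> X" using J D edge finite_subset by (blast, blast)
    have "J \<subseteq> edges_in E (\<Union>J)" using J D by (auto simp: edges_in_def)
    then have "card J \<le> card (edges_in E (\<Union>J))" using U(1) by (intro card_mono finite_edges_in)
    also have "\<dots> \<le> card (\<Union>J)" using sparseD(1)[OF sparse U(2,1)] by (simp add: delta_def)
    finally show ?thesis by simp
  qed
  moreover have "finite (id e)" if "e \<in> D" for e using edge that D(1) by auto
  ultimately have "\<exists>r. inj_on r D \<and> (\<forall>e\<in>D. r e \<in> id e)" using D(2) by (intro marriage)
  then obtain r where r: "inj_on r D" "\<forall>e\<in>D. r e \<in> e" by auto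
  define y where "y = (\<lambda>k. if \<exists>e\<in>D. k = slot (r e) e then 1 else 0 :: real)"
  have ow: "owns y x e \<longleftrightarrow> x = r e" if "e \<in> D" for x e
  proof -
    have "(\<exists>e'\<in>D. slot x e = slot (r e') e') \<longleftrightarrow> x = r e"
      using that D edge slot_eq_iff by (metis subsetD)
    then show ?thesis using that D r(2) by (auto simp: owns_def y_def)
  qed
  have "orients y D" using ow r(1) by (auto simp: orients_def inj_on_def)
  moreover have "y \<in> topspace cantor_cube" unfolding topspace_cantor_cube by (auto simp: y_def)
  ultimately show ?thesis by blast
qed

lemma compact_space_cantor_cube: "compact_space cantor_cube"
  by (simp add: compact_space_product_topology compact_space_discrete_topology)

lemma orientations_nonempty: "orientations \<noteq> {}"
proof -
  define S where "S D = {y \<in> topspace cantor_cube. orients y D}" for D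
  let ?U = "S ` {D. finite D \<and> D \<subseteq> E}"
  have "\<Inter>?U \<noteq> {}"
  proof (rule compact_space_cantor_cube[unfolded compact_space_fip, rule_format], intro conjI allI impI ballI)
    show "closedin cantor_cube K" if "K \<in> ?U" for K
      using that closedin_orients by (auto simp: S_def simp del: topspace_product_topology)
    fix \<F> assume F: "finite \<F> \<and> \<F> \<subseteq> ?U"
    from finite_subset_image[OF conjunct1[OF F] conjunct2[OF F]]
    obtain \<D> where \<D>: "\<D> \<subseteq> {D. finite D \<and> D \<subseteq> E}" "finite \<D>" "\<F> = S ` \<D>" by metis
    have "\<Union>\<D> \<subseteq> E" "finite (\<Union>\<D>)" using \<D>(1,2) by auto
    from finite_orientable[OF this]
    obtain y where y: "y \<in> topspace cantor_cube" "orients y (\<Union>\<D>)" by (elim bexE)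
    have "y \<in> S D" if D: "D \<in> \<D>" for D
      unfolding S_def using y(1) orients_subset[OF y(2) Union_upper[OF D]] by simp
    then have "y \<in> \<Inter>\<F>" unfolding \<D>(3) by (rule INT_I)
    then show "\<Inter>\<F> \<noteq> {}" by blast
  qed
  then obtain y where "y \<in> \<Inter>?U" by blast
  then have y: "y \<in> S D" if "finite D" "D \<subseteq> E" for D using that by auto
  then have "orients y D" if "finite D" "D \<subseteq> E" for D using that by (simp add: S_def)
  moreover have "y \<in> topspace cantor_cube" using y[of "{}"] by (simp add: S_def)
  ultimately show ?thesis using orients_finitary[of E y] by (auto simp: orientations_def)
qed

lemma openin_shift_fibre:
  "openin (subtopology (sym_topology X) aut) {g \<in> aut. shift (inv\<^bsub>autgroup\<^esub> g) k = l}"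
proof (rule openin_sym_subtopologyI)
  fix g assume "g \<in> {g \<in> aut. shift (inv\<^bsub>autgroup\<^esub> g) k = l}"
  then have g: "g \<in> aut" "shift (inv\<^bsub>autgroup\<^esub> g) k = l" by auto
  show "\<exists>J. finite J \<and> J \<subseteq> X \<and> (\<forall>h\<in>aut. (\<forall>j\<in>J. h j = g j) \<longrightarrow>
      h \<in> {g \<in> aut. shift (inv\<^bsub>autgroup\<^esub> g) k = l})"
  proof (cases rule: shift_cases[of k])
    case (1 x e)
    \<comment> \<open>Inverses must agree on \<open>x\<close> and \<open>e\<close>, so
      \<open>h\<close> and \<open>g\<close> are compared on the preimages of these points.\<close>
    let ?J = "(inv\<^bsub>autgroup\<^esub> g) ` insert x e"
    have "shift (inv\<^bsub>autgroup\<^esub> h) k = l" if h: "h \<in> aut" "\<forall>j\<in>?J. h j = g j" for h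
    proof -
      have "(inv\<^bsub>autgroup\<^esub> h) z = (inv\<^bsub>autgroup\<^esub> g) z" if z: "z \<in> insert x e" for z
      proof -
        have zX: "z \<in> X" using z 1 by auto
        have "h ((inv\<^bsub>autgroup\<^esub> g) z) = g ((inv\<^bsub>autgroup\<^esub> g) z)" using h(2) z by blast
        also have "\<dots> = z" using g(1) zX by simp
        finally have "h ((inv\<^bsub>autgroup\<^esub> g) z) = z" .
        moreover have "(inv\<^bsub>autgroup\<^esub> g) z \<in> X" using aut_mem g zX by simp
        ultimately show ?thesis using aut_inv_left[OF h(1)] by metis
      qed
      then have "shift (inv\<^bsub>autgroup\<^esub> h) k = shift (inv\<^bsub>autgroup\<^esub> g) k"
        using 1 by (auto simp: shift_slot intro!: arg_cong[where f = "slot _"])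
      then show ?thesis using g(2) by simp
    qed
    moreover have "finite ?J" "?J \<subseteq> X" using 1 aut_mem[OF inv_aut[OF g(1)]] by auto
    ultimately show ?thesis by (intro exI[of _ ?J]) auto
  next
    case 2
    then show ?thesis using g by (intro exI[of _ "{}"]) auto
  qed
qed (use aut_Bij in auto)

theorem flow_act: "flow aut X (subtopology cantor_cube orientations) act"
  unfolding flow_def
proof (intro conjI)
  let ?Y = "subtopology cantor_cube orientations" and ?G = "subtopology (sym_topology X) aut"
  have closed: "closedin cantor_cube orientations"
    unfolding orientations_def by (rule closedin_orients) simp
  have top: "topspace ?Y = orientations" using closedin_subset[OF closed] by auto
  show "topspace ?Y \<noteq> {}" unfolding top by (rule orientations_nonempty)
  show "compact_space ?Y"
    using closedin_compact_space[OF compact_space_cantor_cube closed] compact_space_subtopology by blast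
  show "Hausdorff_space ?Y"
    by (intro Hausdorff_space_subtopology) (simp add: Hausdorff_space_product_topology)
  show "group_action autgroup (topspace ?Y) act" unfolding top by (rule group_action_act)
  have coord: "continuous_map (prod_topology ?G ?Y) (discrete_topology {0, 1}) (\<lambda>p. (case p of (g, y) \<Rightarrow> act g y) k)" for k
    unfolding continuous_map_def
  proof (intro conjI allI impI)
    show "(\<lambda>p. (case p of (g, y) \<Rightarrow> act g y) k) \<in>
        topspace (prod_topology ?G ?Y) \<rightarrow> topspace (discrete_topology {0, 1})"
    proof
      fix p assume "p \<in> topspace (prod_topology ?G ?Y)"
      then obtain g y where p: "p = (g, y)" "g \<in> aut" "y \<in> orientations" by (auto simp: top)
      then have "act g y \<in> topspace cantor_cube" using act_orientations by (simp add: orientations_def)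
      then show "(case p of (g, y) \<Rightarrow> act g y) k \<in> topspace (discrete_topology {0, 1})"
        unfolding topspace_cantor_cube using p(1) by auto
    qed
    fix U :: "real set" assume "openin (discrete_topology {0, 1}) U"
    then have U: "U \<subseteq> {0, 1}" by simp
    \<comment> \<open>Coordinate \<open>k\<close> of the image is coordinate \<open>l\<close> of
      \<open>y\<close>, where \<open>l\<close> is locally constant in \<open>g\<close>; the preimage
      is thus a union of open rectangles, which gives joint continuity.\<close>
    let ?P = "\<lambda>l. {g \<in> aut. shift (inv\<^bsub>autgroup\<^esub> g) k = l} \<times> {y \<in> orientations. y l \<in> U}"
    have "{p \<in> topspace (prod_topology ?G ?Y). (case p of (g, y) \<Rightarrow> act g y) k \<in> U} = (\<Union>l. ?P l)"
      unfolding topspace_prod_topology top using aut_Bij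
      by (auto simp: topspace_sym_topology act_def)
    moreover have "openin ?Y {y \<in> orientations. y l \<in> U}" for l
    proof -
      have "openin cantor_cube {y \<in> topspace cantor_cube. y l \<in> U}"
        using U by (intro openin_continuous_map_preimage[OF continuous_map_product_projection]) auto
      moreover have "{y \<in> orientations. y l \<in> U} = {y \<in> topspace cantor_cube. y l \<in> U} \<inter> orientations"
        by (auto simp: orientations_def)
      ultimately show ?thesis unfolding openin_subtopology by blast
    qed
    ultimately show "openin (prod_topology ?G ?Y)
        {p \<in> topspace (prod_topology ?G ?Y). (case p of (g, y) \<Rightarrow> act g y) k \<in> U}"
      using openin_shift_fibre by (auto intro!: openin_Union simp: openin_prod_Times_iff)
  qed
  show "continuous_map (prod_topology ?G ?Y) ?Y (\<lambda>(g, y). act g y)"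
    unfolding continuous_map_in_subtopology
  proof (intro conjI)
    show "continuous_map (prod_topology ?G ?Y) cantor_cube (\<lambda>(g, y). act g y)"
      unfolding continuous_map_componentwise_UNIV using coord by blast
    show "(\<lambda>(g, y). act g y) \<in> topspace (prod_topology ?G ?Y) \<rightarrow> orientations"
      using act_orientations by (auto simp: top)
  qed
qed

end

section \<open>Orbits of orientations\<close>

context generic_structure
begin

interpretation autgroup: group autgroup by (rule group_autgroup)

text \<open>The richness property realises a single point over the empty set.\<close>

lemma X_nonempty: "X \<noteq> {}"
proof -
  have d: "delta {} A = int (card A)" for A :: "nat set" by (simp add: delta_def edges_in_def)
  have "sparse {} {0::nat}" by (simp add: sparse_def d)
  moreover have "strong {} {} {0::nat}" by (rule strong_empty[OF calculation])
  moreover have "embeds {} {} E id"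
    using sparse_no_empty_edge[OF sparse] by (simp add: embeds_def)
  ultimately obtain f where "strong E (f ` {0}) X"
    using extension[of "{0}" "{}" "{}" id] strong_empty[OF sparse] by auto
  from strong_subsetD[OF this] show ?thesis by auto
qed

fun reach :: "(nat \<Rightarrow> real) \<Rightarrow> nat \<Rightarrow> nat \<Rightarrow> nat set" where
  "reach y a 0 = {a}"
| "reach y a (Suc n) = reach y a n \<union> \<Union>{e. \<exists>x\<in>reach y a n. owns y x e}"

lemma reach_mono: "m \<le> n \<Longrightarrow> reach y a m \<subseteq> reach y a n"
  by (rule lift_Suc_mono_le[of "reach y a"]) auto

lemma reach_subset: "a \<in> X \<Longrightarrow> reach y a n \<subseteq> X"
  by (induction n) (auto dest: owns_mem)

lemma reach_step: "x \<in> reach y a n \<Longrightarrow> owns y x e \<Longrightarrow> e \<subseteq> reach y a (Suc n)"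
  by auto

lemma owner_unique:
  assumes "y \<in> orientations" "owns y x e" "owns y x e'"
  shows "e = e'"
  using assms owns_mem unfolding orientations_def orients_def by blast

lemma owned_unique:
  assumes "y \<in> orientations" "owns y x e" "owns y x' e"
  shows "x = x'"
  using assms owns_mem unfolding orientations_def orients_def by blast

lemma owned_exists:
  assumes "y \<in> orientations" "e \<in> E"
  shows "\<exists>x. owns y x e"
  using assms unfolding orientations_def orients_def by blast

text \<open>Every point is owned by at most one edge, and edges are finite.\<close>

lemma finite_reach:
  assumes "y \<in> orientations"
  shows "finite (reach y a n)"
proof (induction n)
  case (Suc n)
  have "{e. \<exists>x\<in>reach y a n. owns y x e} \<subseteq> (\<lambda>x. THE e. owns y x e) ` reach y a n"
  proof
    fix e assume "e \<in> {e. \<exists>x\<in>reach y a n. owns y x e}"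
    then obtain x where x: "x \<in> reach y a n" "owns y x e" by blast
    have "(THE e. owns y x e) = e" using x(2) owner_unique[OF assms] by (intro the_equality) auto
    then show "e \<in> (\<lambda>x. THE e. owns y x e) ` reach y a n" using x(1) by force
  qed
  then have "finite {e. \<exists>x\<in>reach y a n. owns y x e}" using Suc finite_surj by blast
  then show ?case using Suc owns_mem by auto
qed simp

lemma owns_act_edge:
  assumes "g \<in> aut" "y \<in> orientations" "owns y x e"
  shows "owns (act g y) (g x) (g ` e)"
  using owns_act[OF assms(1,2)] owns_mem[OF assms(3)] assms(3) by blast

lemma act_inv:
  assumes "g \<in> aut" "y \<in> orientations"
  shows "act (inv\<^bsub>autgroup\<^esub> g) (act g y) = y"
  using group_action.orbit_sym_aux[OF group_action_act, of g y "act g y"] assms by simp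

lemma owns_act_inv:
  assumes g: "g \<in> aut" and y: "y \<in> orientations" and "owns (act g y) x e"
  shows "owns y ((inv\<^bsub>autgroup\<^esub> g) x) ((inv\<^bsub>autgroup\<^esub> g) ` e)"
  using owns_act_edge[OF inv_aut[OF g] act_orientations[OF g y] assms(3)] act_inv[OF g y] by simp

lemma reach_act:
  assumes "g \<in> aut" "y \<in> orientations" "a \<in> X"
  shows "reach (act g y) (g a) n = g ` reach y a n"
proof (induction n)
  case (Suc n)
  have R: "reach y a n \<subseteq> X" using assms(3) by (rule reach_subset)
  have "{e. \<exists>x\<in>g ` reach y a n. owns (act g y) x e} = (`) g ` {e. \<exists>x\<in>reach y a n. owns y x e}"
  proof
    show "{e. \<exists>x\<in>g ` reach y a n. owns (act g y) x e} \<subseteq> (`) g ` {e. \<exists>x\<in>reach y a n. owns y x e}"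
    proof
      fix e assume "e \<in> {e. \<exists>x\<in>g ` reach y a n. owns (act g y) x e}"
      then obtain x where x: "x \<in> reach y a n" "owns (act g y) (g x) e" by blast
      have "owns y x ((inv\<^bsub>autgroup\<^esub> g) ` e)"
        using owns_act_inv[OF assms(1,2) x(2)] x(1) R assms(1) by auto
      moreover have "g ` (inv\<^bsub>autgroup\<^esub> g) ` e = e"
        using owns_mem[OF x(2)] assms(1) by (intro aut_image_inv_right) auto
      ultimately show "e \<in> (`) g ` {e. \<exists>x\<in>reach y a n. owns y x e}"
        using x(1) by (intro image_eqI[of _ _ "(inv\<^bsub>autgroup\<^esub> g) ` e"]) auto
    qed
    show "(`) g ` {e. \<exists>x\<in>reach y a n. owns y x e} \<subseteq> {e. \<exists>x\<in>g ` reach y a n. owns (act g y) x e}"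
      using owns_act_edge[OF assms(1,2)] by blast
  qed
  then show ?case using Suc by (simp add: image_Un image_Union)
qed simp

text \<open>The property that separates orbit pieces: it is open in \<open>y\<close>, is carried
  along by automorphisms, and fails along a piece once \<open>K\<close> is chosen from
  \<open>reach\<close>.\<close>

definition big_edge :: "nat \<Rightarrow> nat \<Rightarrow> nat \<Rightarrow> (nat \<Rightarrow> real) \<Rightarrow> bool" where
  "big_edge a n K y \<longleftrightarrow> (\<exists>x\<in>reach y a n. \<exists>e. owns y x e \<and> K < card e)"

lemma big_edge_act:
  assumes g: "g \<in> aut" and y: "y \<in> orientations" and a: "a \<in> X" and "big_edge a n K y"
  shows "big_edge (g a) n K (act g y)"
proof -
  obtain x e where x: "x \<in> reach y a n" "owns y x e" "K < card e"
    using assms(4) by (auto simp: big_edge_def)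
  have "card (g ` e) = card e"
    using owns_mem[OF x(2)] inj_on_subset[OF aut_inj[OF g]] by (intro card_image) blast
  then show ?thesis
    unfolding big_edge_def reach_act[OF g y a]
    using x owns_act_edge[OF g y x(2)] by (intro bexI[of _ "g x"] exI[of _ "g ` e"]) auto
qed

text \<open>An edge owning a point reached in \<open>n\<close> steps is contained in what is reached
  in \<open>n + 1\<close> steps, hence \<open>Suc n\<close> in the bound.\<close>

lemma not_big_edge:
  assumes "y \<in> orientations"
  shows "\<not> big_edge a n (card (reach y a (Suc n))) y"
proof
  assume "big_edge a n (card (reach y a (Suc n))) y"
  then obtain x e where x: "x \<in> reach y a n" "owns y x e" "card (reach y a (Suc n)) < card e"
    by (auto simp: big_edge_def)
  have "card e \<le> card (reach y a (Suc n))"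
    by (rule card_mono[OF finite_reach[OF assms] reach_step[OF x(1,2)]])
  then show False using x(3) by simp
qed

lemma reach_local:
  "x \<in> reach y a n \<Longrightarrow> \<exists>J. finite J \<and> (\<forall>z. (\<forall>k\<in>J. z k = y k) \<longrightarrow> x \<in> reach z a n)"
proof (induction n arbitrary: x)
  case 0
  then show ?case by (intro exI[of _ "{}"]) simp
next
  case (Suc n)
  show ?case
  proof (cases "x \<in> reach y a n")
    case True
    from Suc.IH[OF this] show ?thesis by auto
  next
    case False
    then obtain w e where w: "w \<in> reach y a n" "owns y w e" "x \<in> e" using Suc.prems by auto
    obtain J where J: "finite J" "\<forall>z. (\<forall>k\<in>J. z k = y k) \<longrightarrow> w \<in> reach z a n"
      using Suc.IH[OF w(1)] by blast
    have "x \<in> reach z a (Suc n)" if z: "\<forall>k\<in>insert (slot w e) J. z k = y k" for z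
    proof -
      have "w \<in> reach z a n" using J(2) z by simp
      moreover have "owns z w e" using w(2) z by (simp add: owns_def)
      ultimately show ?thesis using w(3) by auto
    qed
    then show ?thesis using J(1) by (intro exI[of _ "insert (slot w e) J"]) simp
  qed
qed

lemma openin_big_edge: "openin cantor_cube {y \<in> topspace cantor_cube. big_edge a n K y}"
  unfolding openin_product_discrete_iff
proof (intro conjI ballI)
  fix y assume y: "y \<in> {y \<in> topspace cantor_cube. big_edge a n K y}"
  then obtain x e where x: "x \<in> reach y a n" "owns y x e" "K < card e"
    by (auto simp: big_edge_def)
  obtain J where J: "finite J" "\<forall>z. (\<forall>k\<in>J. z k = y k) \<longrightarrow> x \<in> reach z a n"
    using reach_local[OF x(1)] by blast
  have "big_edge a n K z" if z: "\<forall>k\<in>insert (slot x e) J. z k = y k" for z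
  proof -
    have "x \<in> reach z a n" using J(2) z by simp
    moreover have "owns z x e" using x(2) z by (simp add: owns_def)
    ultimately show ?thesis using x(3) by (auto simp: big_edge_def)
  qed
  then show "\<exists>J. finite J \<and> J \<subseteq> UNIV \<and> (\<forall>z\<in>UNIV \<rightarrow>\<^sub>E {0, 1}. (\<forall>k\<in>J. z k = y k) \<longrightarrow>
      z \<in> {y \<in> topspace cantor_cube. big_edge a n K y})"
    using J(1) by (intro exI[of _ "insert (slot x e) J"]) simp
qed auto

text \<open>Distinct edges inside \<open>C\<close> own distinct points of \<open>C\<close>, so at
  most \<delta>(C) points of \<open>C\<close> are not owned from inside \<open>C\<close>. That is
  fewer than \<open>m\<close>, and some of the \<open>m\<close> disjoint sets contains none of
  them.\<close>

lemma pigeonhole_owned: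
  fixes m :: nat
  assumes y: "y \<in> orientations" and C: "finite C" "C \<subseteq> X" "delta E C < int m"
    and B: "\<And>j. j < m \<Longrightarrow> B j \<subseteq> C"
    and disj: "\<And>i j. i < m \<Longrightarrow> j < m \<Longrightarrow> i \<noteq> j \<Longrightarrow> B i \<inter> B j = {}"
  shows "\<exists>j<m. \<forall>x\<in>B j. \<exists>e\<subseteq>C. owns y x e"
proof (rule ccontr)
  assume "\<not> ?thesis"
  then have "\<forall>j\<in>{..<m}. \<exists>x. x \<in> B j \<and> \<not> (\<exists>e\<subseteq>C. owns y x e)" by auto
  from bchoice[OF this] obtain u
    where u: "\<And>j. j < m \<Longrightarrow> u j \<in> B j \<and> \<not> (\<exists>e\<subseteq>C. owns y (u j) e)" by auto
  define P where "P = {x \<in> C. \<exists>e\<subseteq>C. owns y x e}"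
  have "\<forall>e\<in>edges_in E C. \<exists>x. owns y x e" using owned_exists[OF y] by (auto simp: edges_in_def)
  from bchoice[OF this] obtain r where r: "\<And>e. e \<in> edges_in E C \<Longrightarrow> owns y (r e) e" by auto
  have "card (edges_in E C) \<le> card P"
  proof (rule card_inj_on_le)
    show "inj_on r (edges_in E C)"
    proof (rule inj_onI)
      fix e e' assume "e \<in> edges_in E C" "e' \<in> edges_in E C" "r e = r e'"
      then show "e = e'" using owner_unique[OF y r, of e e'] r[of e'] by simp
    qed
    show "r ` edges_in E C \<subseteq> P"
    proof (rule image_subsetI)
      fix e assume e: "e \<in> edges_in E C"
      then have eC: "e \<subseteq> C" by (simp add: edges_in_def)
      have "r e \<in> C" using owns_mem[OF r[OF e]] eC by blast
      then show "r e \<in> P" unfolding P_def using r[OF e] eC by blast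
    qed
    show "finite P" using C(1) by (simp add: P_def)
  qed
  moreover have "card P + m \<le> card C"
  proof -
    have "inj_on u {..<m}"
    proof (rule inj_onI)
      fix i j assume ij: "i \<in> {..<m}" "j \<in> {..<m}" "u i = u j"
      show "i = j"
      proof (rule ccontr)
        assume "i \<noteq> j"
        then have "B i \<inter> B j = {}" using ij by (intro disj) auto
        then show False using u[of i] u[of j] ij by auto
      qed
    qed
    then have "card (u ` {..<m}) = m" by (simp add: card_image)
    moreover have "u ` {..<m} \<inter> P = {}" using u by (auto simp: P_def)
    moreover have "u ` {..<m} \<union> P \<subseteq> C" using u B by (auto simp: P_def)
    ultimately show ?thesis
      using card_mono[OF C(1), of "u ` {..<m} \<union> P"] card_Un_disjoint[of "u ` {..<m}" P] C(1)
      by (simp add: P_def)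
  qed
  ultimately show False using C(3) by (simp add: delta_def)
qed

text \<open>Otherwise each step adds a point, starting from one point, and after
  \<open>card F\<close> steps there are more than \<open>card F\<close> points.\<close>

lemma reach_stabilises:
  assumes "finite F" "F \<noteq> {}" "\<And>i. i \<le> card F \<Longrightarrow> reach y a i \<subseteq> F"
  shows "\<exists>i<card F. reach y a (Suc i) = reach y a i"
proof (rule ccontr)
  assume n: "\<not> ?thesis"
  have "i < card (reach y a i)" if "i \<le> card F" for i
    using that
  proof (induction i)
    case (Suc i)
    have "reach y a (Suc i) \<noteq> reach y a i" using n Suc.prems by (metis Suc_le_lessD)
    moreover have "reach y a i \<subseteq> reach y a (Suc i)" by (rule reach_mono) simp
    ultimately have "reach y a i \<subset> reach y a (Suc i)" by blast
    moreover have "finite (reach y a (Suc i))"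
      using assms(1,3) Suc.prems finite_subset by blast
    ultimately have "card (reach y a i) < card (reach y a (Suc i))" by (rule psubset_card_mono[rotated])
    then show ?case using Suc by simp
  qed simp
  then have "card F < card (reach y a (card F))" by simp
  moreover have "card (reach y a (card F)) \<le> card F" using assms by (intro card_mono) auto
  ultimately show False by simp
qed

text \<open>Linked copies of \<open>F\<close> have fewer free vertices than copies, so all points of some copy are
  owned, while the edges inside one copy cannot be closed under ownership.\<close>

lemma big_edge_translate:
  assumes y: "y \<in> orientations" and F: "finite F" "F \<noteq> {}" "strong E F X"
  shows "\<exists>h\<in>aut. \<forall>f\<in>F. big_edge f (card F) K (act h y)"
proof -
  obtain m :: nat and h where h: "\<And>j. j < m \<Longrightarrow> h j \<in> aut"
    and disj: "\<And>i j. i < m \<Longrightarrow> j < m \<Longrightarrow> i \<noteq> j \<Longrightarrow> h i ` F \<inter> h j ` F = {}"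
    and small: "delta E (\<Union>j<m. h j ` F) < int m"
    and edges: "\<And>e. e \<in> E \<Longrightarrow> e \<subseteq> (\<Union>j<m. h j ` F) \<Longrightarrow> (\<exists>j<m. e \<subseteq> h j ` F) \<or> K < card e"
    using linked_copies_exist[OF F, of K] by blast
  have FX: "F \<subseteq> X" using F(3) by (rule strong_subsetD)
  define C where "C = (\<Union>j<m. h j ` F)"
  have "\<exists>j<m. \<forall>x\<in>h j ` F. \<exists>e\<subseteq>C. owns y x e"
  proof (rule pigeonhole_owned[OF y])
    show "finite C" using F(1) by (simp add: C_def)
    show "C \<subseteq> X" using h aut_mem FX by (auto simp: C_def)
    show "delta E C < int m" using small by (simp add: C_def)
    show "h j ` F \<subseteq> C" if "j < m" for j using that by (auto simp: C_def)
  qed (rule disj)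
  then obtain j where j: "j < m" "\<And>x. x \<in> F \<Longrightarrow> \<exists>e\<subseteq>C. owns y (h j x) e" by blast
  \<comment> \<open>The fully owned copy is pulled back to \<open>F\<close> itself; the translate
    \<open>z\<close> is the required witness.\<close>
  let ?h = "h j" and ?g = "inv\<^bsub>autgroup\<^esub> (h j)"
  define z where "z = act ?g y"
  have hj: "?h \<in> aut" using h[OF j(1)] .
  have z: "z \<in> orientations" unfolding z_def using act_orientations[OF inv_aut[OF hj] y] .
  have yz: "act ?h z = y"
    using act_inv[OF inv_aut[OF hj] y] autgroup.inv_inv[of ?h] hj by (simp add: z_def)
  have "big_edge f (card F) K z" if f: "f \<in> F" for f
  proof (rule ccontr)
    assume nb: "\<not> big_edge f (card F) K z"
    \<comment> \<open>Without a large edge within reach, the edge owning the image of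
      \<open>x\<close> has at most \<open>K\<close> points, so it lies inside one copy. It contains
      a point of copy \<open>j\<close>, and copies are disjoint, so it lies in copy
      \<open>j\<close>.\<close>
    have owned: "\<exists>e\<subseteq>F. owns z x e" if x: "x \<in> F" and i: "x \<in> reach z f i" "i \<le> card F" for x i
    proof -
      obtain e' where e': "e' \<subseteq> C" "owns y (?h x) e'" using j(2)[OF x] by blast
      define e where "e = ?g ` e'"
      have e: "owns z x e"
        using owns_act_edge[OF inv_aut[OF hj] y e'(2)] x FX hj by (auto simp: z_def e_def)
      have he: "?h ` e = e'"
        unfolding e_def using owns_mem[OF e'(2)] hj by (intro aut_image_inv_right) auto
      have eX: "e \<subseteq> X" using owns_mem[OF e] by blast
      have "x \<in> reach z f (card F)" using i reach_mono[of i "card F" z f] by blast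
      then have "card e \<le> K" using nb e unfolding big_edge_def by (meson not_le)
      moreover have "card e' = card e"
        using card_image[OF inj_on_subset[OF aut_inj[OF hj] eX]] he by simp
      ultimately obtain k where k: "k < m" "e' \<subseteq> h k ` F"
        using edges[of e'] e'(1) owns_mem[OF e'(2)] by (auto simp: C_def)
      have "?h x \<in> h k ` F \<inter> ?h ` F" using k(2) owns_mem[OF e'(2)] x by blast
      then have "k = j" using disj[OF k(1) j(1)] by blast
      have "e \<subseteq> F"
      proof
        fix w assume w: "w \<in> e"
        then obtain v where "v \<in> F" "?h w = ?h v" using k(2) he \<open>k = j\<close> by blast
        then show "w \<in> F" using inj_onD[OF aut_inj[OF hj], of w v] w eX FX by blast
      qed
      then show ?thesis using e by blast
    qed
    have R: "reach z f i \<subseteq> F" if "i \<le> card F" for i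
      using that
    proof (induction i)
      case (Suc i)
      then have IH: "reach z f i \<subseteq> F" by simp
      have "e \<subseteq> F" if xe: "x \<in> reach z f i" "owns z x e" for x e
      proof -
        obtain e0 where "e0 \<subseteq> F" "owns z x e0"
          using owned[of x i] IH xe(1) Suc.prems by auto
        then show ?thesis using owner_unique[OF z xe(2)] by blast
      qed
      then show ?case using IH by auto
    qed (use f in simp)
    obtain i where i: "i < card F" "reach z f (Suc i) = reach z f i"
      using reach_stabilises[OF F(1,2) R] by blast
    let ?R = "reach z f i"
    have RX: "?R \<subseteq> X" using FX f by (intro reach_subset) blast
    have "\<forall>x\<in>?R. \<exists>e. e \<subseteq> ?R \<and> owns z x e"
    proof
      fix x assume x: "x \<in> ?R"
      then obtain e where e: "owns z x e" using owned[of x i] R[of i] i(1) by auto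
      then have "e \<subseteq> ?R" using reach_step[OF x e] i(2) by simp
      then show "\<exists>e. e \<subseteq> ?R \<and> owns z x e" using e by blast
    qed
    from bchoice[OF this] obtain r where r: "\<And>x. x \<in> ?R \<Longrightarrow> r x \<subseteq> ?R \<and> owns z x (r x)" by auto
    \<comment> \<open>An edge owns only one point, so distinct points of the closed set
      \<open>?R\<close> have distinct owners inside it; this contradicts positive
      predimension.\<close>
    have "card ?R \<le> card (edges_in E ?R)"
    proof (rule card_inj_on_le)
      show "inj_on r ?R"
      proof (rule inj_onI)
        fix x x' assume "x \<in> ?R" "x' \<in> ?R" "r x = r x'"
        then show "x = x'" using owned_unique[OF z] r by metis
      qed
      show "r ` ?R \<subseteq> edges_in E ?R"
      proof (rule image_subsetI)
        fix x assume "x \<in> ?R"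
        from r[OF this] owns_mem[of z x "r x"] show "r x \<in> edges_in E ?R"
          by (simp add: edges_in_def)
      qed
      show "finite (edges_in E ?R)" by (intro finite_edges_in finite_reach z)
    qed
    moreover have "?R \<noteq> {}" using reach_mono[of 0 i z f] by auto
    then have "1 \<le> delta E ?R" by (rule sparse_delta_pos[OF sparse RX finite_reach[OF z]])
    ultimately show False by (simp add: delta_def)
  qed
  then show ?thesis using inv_aut[OF hj] unfolding z_def by blast
qed

end

section \<open>Meagreness of the orbits in a minimal subflow\<close>

context generic_structure
begin

interpretation autgroup: group autgroup by (rule group_autgroup)

lemma aut_subset_Bij: "aut \<subseteq> Bij X"
  using aut_Bij by blast

lemma nowhere_dense_orbit_piece:
  assumes Z: "Z \<subseteq> orientations" "\<And>g. g \<in> aut \<Longrightarrow> act g ` Z \<subseteq> Z"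
    and minimal: "minimal_flow aut X (subtopology (subtopology cantor_cube orientations) Z)
      (\<lambda>g. restrict (act g) Z)"
    and y: "y \<in> Z" and a: "a \<in> X" and b: "b \<in> X"
  shows "nowhere_dense_in (subtopology (subtopology cantor_cube orientations) Z)
    {act g y | g. g \<in> aut \<and> g a = b}"
proof -
  let ?T = "subtopology (subtopology cantor_cube orientations) Z"
  let ?N = "{act g y | g. g \<in> aut \<and> g a = b}"
  have flow: "flow aut X ?T (\<lambda>g. restrict (act g) Z)"
    using minimal by (simp add: minimal_flow_def)
  have T: "?T = subtopology cantor_cube Z"
    using Z(1) by (simp add: subtopology_subtopology Int_absorb1)
  have top: "topspace ?T = Z"
  proof -
    have "Z \<subseteq> topspace cantor_cube" using Z(1) by (auto simp: orientations_def)
    then show ?thesis unfolding T by (rule topspace_subtopology_subset)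
  qed
  have N: "?N \<subseteq> Z" using Z(2) y by blast
  define U where "U = ?T interior_of (?T closure_of ?N)"
  have "U = {}"
  proof (rule ccontr)
    assume "U \<noteq> {}"
    then obtain u where u: "u \<in> U" by blast
    have oU: "openin ?T U" unfolding U_def by (rule openin_interior_of)
    have UZ: "U \<subseteq> Z" using openin_subset[OF oU] top by simp
    \<comment> \<open>The bound depends on \<open>y\<close>, \<open>a\<close> and \<open>n\<close>,
      but not on the automorphism that moves \<open>a\<close> to \<open>b\<close>.\<close>
    define K where "K n = card (reach y a (Suc n))" for n
    have yO: "y \<in> orientations" using y Z(1) by blast
    \<comment> \<open>A large edge near \<open>b\<close> would persist on an open part of
      \<open>U\<close>. That part meets the orbit piece, as \<open>U\<close> lies in its closure,
      and pulling back gives a large edge near \<open>a\<close> in \<open>y\<close>.\<close>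
    have no_big: "\<not> big_edge b n (K n) z" if z: "z \<in> U" for n z
    proof
      assume big: "big_edge b n (K n) z"
      let ?W = "U \<inter> {z \<in> Z. big_edge b n (K n) z}"
      have "openin ?T {z \<in> Z. big_edge b n (K n) z}"
      proof -
        have "{z \<in> Z. big_edge b n (K n) z} = {z \<in> topspace cantor_cube. big_edge b n (K n) z} \<inter> Z"
          using Z(1) by (auto simp: orientations_def)
        then show ?thesis unfolding T openin_subtopology using openin_big_edge by metis
      qed
      then have W: "openin ?T ?W" using oU by (rule openin_Int[rotated])
      have "?W \<inter> ?N = {}"
      proof (rule equals0I)
        fix w assume "w \<in> ?W \<inter> ?N"
        then obtain g where g: "g \<in> aut" "g a = b" "w = act g y" "big_edge b n (K n) w" by blast
        have "big_edge ((inv\<^bsub>autgroup\<^esub> g) b) n (K n) (act (inv\<^bsub>autgroup\<^esub> g) w)"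
          using g(4) act_orientations[OF g(1) yO] b g(1,3) by (intro big_edge_act) auto
        then have "big_edge a n (K n) y"
          using act_inv[OF g(1) yO] aut_inv_left[OF g(1) a] by (simp add: g(2,3))
        then show False using not_big_edge[OF yO] by (simp add: K_def)
      qed
      then have "?W \<inter> ?T closure_of ?N = {}" using openin_Int_closure_of_eq_empty[OF W] by blast
      moreover have "U \<subseteq> ?T closure_of ?N" unfolding U_def by (rule interior_of_subset)
      ultimately show False using z big UZ by blast
    qed
    \<comment> \<open>By minimality every orbit enters \<open>U\<close>, so these open sets cover
      \<open>Z\<close>, and compactness leaves finitely many \<open>g\<close>.\<close>
    define V where "V g = {z \<in> Z. restrict (act g) Z z \<in> U}" for g
    have oV: "openin ?T (V g)" if "g \<in> aut" for g
      using openin_continuous_map_preimage[OF continuous_map_flow[OF flow aut_subset_Bij that] oU]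
      unfolding V_def top .
    have cover: "\<exists>g\<in>aut. z \<in> V g" if z: "z \<in> Z" for z
    proof -
      have "u \<in> ?T closure_of (orbit autgroup (\<lambda>g. restrict (act g) Z) z)"
        using minimal z u UZ unfolding minimal_flow_def top by blast
      then obtain w where "w \<in> orbit autgroup (\<lambda>g. restrict (act g) Z) z" "w \<in> U"
        using u oU unfolding in_closure_of by blast
      then show ?thesis using z by (auto simp: orbit_def V_def)
    qed
    have "compactin ?T Z" using flow top unfolding flow_def compact_space_def by simp
    then have "\<exists>\<F>. finite \<F> \<and> \<F> \<subseteq> V ` aut \<and> Z \<subseteq> \<Union>\<F>"
    proof (rule compactinD)
      show "openin ?T W" if "W \<in> V ` aut" for W using oV that by (elim imageE) simp
      show "Z \<subseteq> \<Union>(V ` aut)" using cover by (simp add: subset_iff)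
    qed
    then obtain \<F> where F': "finite \<F>" "\<F> \<subseteq> V ` aut" "Z \<subseteq> \<Union>\<F>" by blast
    then obtain \<Gamma> where \<Gamma>: "\<Gamma> \<subseteq> aut" "finite \<Gamma>" "\<F> = V ` \<Gamma>" using finite_subset_image by metis
    \<comment> \<open>If \<open>g\<close> moves \<open>z\<close> into \<open>U\<close>, then
      \<open>no_big\<close> at \<open>b\<close> becomes the same bound for \<open>z\<close> at the
      point that \<open>g\<close> sends to \<open>b\<close>. These finitely many points are
      collected here.\<close>
    define F0 where "F0 = (\<lambda>g. (inv\<^bsub>autgroup\<^esub> g) b) ` \<Gamma>"
    have "finite F0" "F0 \<subseteq> X" using \<Gamma>(1,2) aut_mem[OF inv_aut _] b by (auto simp: F0_def)
    then obtain F where F: "finite F" "F0 \<subseteq> F" "strong E F X"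
      using exists_strong_closure[OF sparse] by metis
    have "F \<noteq> {}" using F(2) F'(3) y by (auto simp: F0_def \<Gamma>(3))
    \<comment> \<open>With \<open>F\<close> fixed, \<open>K (card F)\<close> is a definite number;
      one translate of \<open>y\<close> exceeds it at all points of \<open>F\<close>
      simultaneously.\<close>
    then obtain h where h: "h \<in> aut" "\<forall>f\<in>F. big_edge f (card F) (K (card F)) (act h y)"
      using big_edge_translate[OF yO F(1) _ F(3)] by blast
    have hy: "act h y \<in> Z" using Z(2)[OF h(1)] y by blast
    then obtain g where g: "g \<in> \<Gamma>" "act h y \<in> V g" using F'(3) \<Gamma>(3) by blast
    then have gU: "act g (act h y) \<in> U" using hy by (simp add: V_def)
    have ga: "g \<in> aut" using g(1) \<Gamma>(1) by blast
    have "(inv\<^bsub>autgroup\<^esub> g) b \<in> F" using g(1) F(2) by (auto simp: F0_def)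
    then have "big_edge ((inv\<^bsub>autgroup\<^esub> g) b) (card F) (K (card F)) (act h y)" using h(2) by blast
    then have "big_edge (g ((inv\<^bsub>autgroup\<^esub> g) b)) (card F) (K (card F)) (act g (act h y))"
      using hy Z(1) aut_mem[OF inv_aut[OF ga] b] by (intro big_edge_act[OF ga]) auto
    then show False using no_big[OF gU] aut_inv_right[OF ga b] by simp
  qed
  then show ?thesis using N unfolding nowhere_dense_in_def top U_def by blast
qed

theorem meagre_minimal_flow:
  "\<exists>Y \<phi>. minimal_flow aut X Y \<phi> \<and> metrizable_space Y \<and>
     (\<forall>orb\<in>orbits autgroup (topspace (Y :: (nat \<Rightarrow> real) topology)) \<phi>. meagre_in Y orb)"
proof -
  let ?Y = "subtopology cantor_cube orientations"
  obtain Z where Z: "closedin ?Y Z" "Z \<noteq> {}" "\<And>g. g \<in> aut \<Longrightarrow> act g ` Z \<subseteq> Z"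
    and minimal: "minimal_flow aut X (subtopology ?Y Z) (\<lambda>g. restrict (act g) Z)"
    using minimal_subflow_exists[OF flow_act aut_subset_Bij] by metis
  let ?T = "subtopology ?Y Z" and ?act = "\<lambda>g. restrict (act g) Z"
  have ZY: "Z \<subseteq> topspace ?Y" using Z(1) by (rule closedin_subset)
  then have ZO: "Z \<subseteq> orientations" by simp
  have top: "topspace ?T = Z" using ZY by (rule topspace_subtopology_subset)
  obtain a where a: "a \<in> X" using X_nonempty by blast
  have "metrizable_space cantor_cube"
    by (simp add: metrizable_space_product_topology metrizable_space_discrete_topology)
  then have "metrizable_space ?T" by (intro metrizable_space_subtopology)
  moreover have "meagre_in ?T orb" if orb: "orb \<in> orbits autgroup (topspace ?T) ?act" for orb
  proof -
    obtain y where y: "y \<in> Z" "orb = orbit autgroup ?act y"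
      using orb unfolding orbits_def top by blast
    \<comment> \<open>The orbit is sorted by the image of \<open>a\<close>; as \<open>X\<close> is
      countable, there are countably many pieces.\<close>
    let ?N = "\<lambda>b. {act g y | g. g \<in> aut \<and> g a = b}"
    have "orb = \<Union>(?N ` X)"
      using y a aut_mem by (auto simp: orbit_def)
    moreover have "countable (?N ` X)" by simp
    moreover have "nowhere_dense_in ?T (?N b)" if "b \<in> X" for b
      using nowhere_dense_orbit_piece[OF ZO Z(3) minimal y(1) a that] .
    ultimately show ?thesis unfolding meagre_in_def by (intro exI[of _ "?N ` X"]) blast
  qed
  ultimately show ?thesis using minimal by blast
qed

end

theorem corollary1p4:
  shows "\<exists>(X :: nat set) (G :: (nat \<Rightarrow> nat) set).
           countable X \<and> closed_permutation_group G X \<and> oligomorphic G X \<and>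
           (\<exists>(Y :: (nat \<Rightarrow> real) topology) (\<phi> :: (nat \<Rightarrow> nat) \<Rightarrow> (nat \<Rightarrow> real) \<Rightarrow> (nat \<Rightarrow> real)).
              minimal_flow G X Y \<phi> \<and> metrizable_space Y \<and>
              (\<forall>orb\<in>orbits (permgroup G X) (topspace Y) \<phi>. meagre_in Y orb))"
proof -
  obtain X E where "generic_structure X E" using generic_structure_exists by blast
  then interpret generic_structure X E .
  show ?thesis
    by (intro exI[of _ X] exI[of _ aut] conjI closed_permutation_group_aut oligomorphic_aut
        meagre_minimal_flow) simp
qed

end
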